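(* Suppose $p=p_n$ satisfies $\frac{\log p_n}{n}\to\infty$ as $n\to\infty$. For each $n$ let $\mathbf{X}_1,\dots,\mathbf{X}_p$ be independent $n$-dimensional random vectors with a common spherical distribution (which may depend on $n$) satisfying $P(\mathbf{X}_1=\mathbf{0})=0$. Let $$\tilde\rho_{ij}=\frac{\mathbf{X}_i^T\mathbf{X}_j}{\|\mathbf{X}_i\|\cdot\|\mathbf{X}_j\|},\qquad \tilde L_n=\max_{1\le i<j\le p}|\tilde\rho_{ij}|,\qquad \tilde T_n=\log(1-\tilde L_n^2).$$ Then: (i) $\tilde L_n\to1$ in probability as $n\to\infty$. Further, $\frac{n}{\log p}\tilde T_n\to-4$ in probability as $n\to\infty$. (ii) As $n\to\infty$, $$n\tilde T_n+\frac{4n}{n-1}\log p-\log n$$ converges weakly to the distribution with distribution function $F(y)=1-e^{-Ke^{y/2}}$, $y\in\mathbb{R}$, where $K=1/\sqrt{2\pi}$.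
   Context: A random vector $\mathbf{Y}\in\mathbb{R}^n$ has a spherical distribution if $\mathbf{O}\mathbf{Y}$ and $\mathbf{Y}$ have the same probability distribution for every $n\times n$ orthogonal matrix $\mathbf{O}$. $\|\cdot\|$ is the Euclidean norm on $\mathbb{R}^n$, $\log$ is the natural logarithm, and $p=p_n$ is an integer depending on $n$ only. *)

theory Defs
  imports "HOL-Probability.Probability"
begin

(* R^n is carried by the extensional functions on {..<n}, so that n may be a bound variable. *)
abbreviation euclid :: "nat \<Rightarrow> (nat \<Rightarrow> real) measure" where
  "euclid n \<equiv> PiM {..<n} (\<lambda>_. borel)"

definition inner_vec :: "nat \<Rightarrow> (nat \<Rightarrow> real) \<Rightarrow> (nat \<Rightarrow> real) \<Rightarrow> real" where
  "inner_vec n x y = (\<Sum>k<n. x k * y k)"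

definition norm_vec :: "nat \<Rightarrow> (nat \<Rightarrow> real) \<Rightarrow> real" where
  "norm_vec n x = L2_set x {..<n}"

definition orthogonal_mat :: "nat \<Rightarrow> (nat \<Rightarrow> nat \<Rightarrow> real) \<Rightarrow> bool" where
  "orthogonal_mat n Q \<longleftrightarrow>
     (\<forall>i<n. \<forall>j<n. (\<Sum>k<n. Q k i * Q k j) = (if i = j then 1 else 0)) \<and>
     (\<forall>i<n. \<forall>j<n. (\<Sum>k<n. Q i k * Q j k) = (if i = j then 1 else 0))"

definition mat_vec :: "nat \<Rightarrow> (nat \<Rightarrow> nat \<Rightarrow> real) \<Rightarrow> (nat \<Rightarrow> real) \<Rightarrow> (nat \<Rightarrow> real)" where
  "mat_vec n Q x = (\<lambda>i\<in>{..<n}. \<Sum>k<n. Q i k * x k)"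

definition spherical :: "'a measure \<Rightarrow> nat \<Rightarrow> ('a \<Rightarrow> nat \<Rightarrow> real) \<Rightarrow> bool" where
  "spherical M n Y \<longleftrightarrow>
     Y \<in> measurable M (euclid n) \<and>
     (\<forall>Q. orthogonal_mat n Q \<longrightarrow>
        distr M (euclid n) (\<lambda>\<omega>. mat_vec n Q (Y \<omega>)) = distr M (euclid n) Y)"

definition rho :: "nat \<Rightarrow> (nat \<Rightarrow> real) \<Rightarrow> (nat \<Rightarrow> real) \<Rightarrow> real" where
  "rho n x y = inner_vec n x y / (norm_vec n x * norm_vec n y)"

(* X i \<omega> is the value of the i-th random vector, i = 1, ..., p.
   The value for p < 2, a maximum over the empty set, is unspecified. *)
definition Lstat :: "nat \<Rightarrow> nat \<Rightarrow> (nat \<Rightarrow> 'a \<Rightarrow> nat \<Rightarrow> real) \<Rightarrow> 'a \<Rightarrow> real" where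
  "Lstat n p X \<omega> = Max {\<bar>rho n (X i \<omega>) (X j \<omega>)\<bar> | i j. 1 \<le> i \<and> i < j \<and> j \<le> p}"

(* Since ln 0 = 0, this is 0 rather than minus infinity where Lstat is 1; under the
   distributions considered this is an event of probability 0 for n and p at least 2. *)
definition Tstat :: "nat \<Rightarrow> nat \<Rightarrow> (nat \<Rightarrow> 'a \<Rightarrow> nat \<Rightarrow> real) \<Rightarrow> 'a \<Rightarrow> real" where
  "Tstat n p X \<omega> = ln (1 - (Lstat n p X \<omega>)\<^sup>2)"

(* Convergence in probability to a constant; the n-th variable lives on its own space M n. *)
definition tendsto_prob :: "(nat \<Rightarrow> 'a measure) \<Rightarrow> (nat \<Rightarrow> 'a \<Rightarrow> real) \<Rightarrow> real \<Rightarrow> bool" where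
  "tendsto_prob M Z c \<longleftrightarrow>
     (\<forall>\<epsilon>>0. (\<lambda>n. measure (M n) {\<omega> \<in> space (M n). \<bar>Z n \<omega> - c\<bar> > \<epsilon>}) \<longlonglongrightarrow> 0)"

end

theory Submission
  imports Defs "HOL-Real_Asymp.Real_Asymp"
begin

text \<open>
Write \<open>\<rho>\<close> for the correlation of two of the vectors and fix \<open>y\<close>. The normalized statistic is at
most \<open>y\<close> exactly when some pair satisfies \<open>\<rho>\<^sup>2 \<ge> 1 - s\<close>, where \<open>s\<close> is the threshold
\<open>exp ((y + log n) / n - 4 log p / (n - 1))\<close>. So part (ii) says that the probability of there being
no such pair tends to \<open>exp (- K e\<^bsup>y/2\<^esup>)\<close>, and the proof has two halves: a Poisson
approximation for the pairs, and the tail of a single \<open>\<rho>\<^sup>2\<close>.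

Poisson approximation. By sphericity, the conditional probability that \<open>X\<^sub>j\<close> is related to a given
nonzero vector (meaning \<open>\<rho>\<^sup>2 \<ge> 1 - s\<close>) is a number \<open>q\<close> which does not depend on that vector.
Reveal the vectors one at a time. If the first \<open>m\<close> are pairwise unrelated, the next one is related
to at least one of them with probability \<open>m q\<close>, up to an error of order \<open>m\<^sup>2 q\<^sup>2\<close> by
Bonferroni, because the events ``related to the first'' and ``related to the second'' are
independent of each other. Multiplying the factors \<open>1 - m q \<approx> exp (- m q)\<close> gives
\<open>exp (- q p (p - 1) / 2)\<close> with an error of at most \<open>p\<^sup>3 q\<^sup>2\<close>
(\<open>prob_unrelated_approx\<close>); this vanishes because \<open>p\<^sup>2 q\<close> stays bounded.

Tail of one pair. For a fixed direction \<open>x\<close>, the square of the correlation of \<open>x\<close> with a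
spherical vector \<open>Y\<close> has the Beta law with parameters \<open>1/2\<close> and \<open>(n - 1)/2\<close>
(\<open>spherical_rho_square_distr\<close>). This is obtained from moments, without any surface measure.
With \<open>V = Y / \<parallel>Y\<parallel>\<close>, sphericity makes \<open>E (V\<^sub>0 + t V\<^sub>j)\<^bsup>2k\<^esup>\<close> equal to
\<open>(1 + t\<^sup>2)\<^sup>k E V\<^sub>0\<^bsup>2k\<^esup>\<close> for all real \<open>t\<close>. Comparing the coefficients of
\<open>t\<^sup>2\<close> and summing over \<open>j\<close>, where \<open>\<Sum> V\<^sub>j\<^sup>2 = 1\<close>, yields the two-term
recursion that the moments of the Beta law satisfy, and a law on \<open>[0, 1]\<close> is determined by its
moments. The Beta density then gives, uniformly in \<open>n\<close> as \<open>s \<rightarrow> 0\<close>,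
\<open>q \<sim> s\<^bsup>(n-1)/2\<^esup> / ((n-1)/2 \<cdot> B(1/2, (n-1)/2))\<close>; with the above \<open>s\<close> and
\<open>\<Gamma>(x + 1/2) / \<Gamma>(x) \<sim> \<surd>x\<close> one finds \<open>q p (p - 1) / 2 \<rightarrow> K e\<^bsup>y/2\<^esup>\<close>
(\<open>expected_pairs_tendsto\<close>). The assumption that \<open>log p / n\<close> tends to infinity is what forces
\<open>s \<rightarrow> 0\<close>.

Part (i) follows from (ii): the normalized statistic is tight, so dividing by \<open>log p\<close> leaves only
the centring \<open>- 4 n / (n - 1) \<rightarrow> - 4\<close>; then \<open>T\<close> tends to minus infinity in probability, that
is, \<open>L\<close> tends to \<open>1\<close>.
\<close>

section \<open>Orthogonal invariance\<close>

lemma inner_vec_self: "inner_vec n x x = (norm_vec n x)\<^sup>2"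
  by (simp add: inner_vec_def norm_vec_def L2_set_def sum_nonneg power2_eq_square)

lemma norm_vec_nonneg: "0 \<le> norm_vec n x"
  by (simp add: norm_vec_def)

lemma norm_vec_eq_0_iff: "norm_vec n x = 0 \<longleftrightarrow> (\<forall>k<n. x k = 0)"
  by (auto simp: norm_vec_def L2_set_eq_0_iff)

lemma abs_inner_vec_le: "\<bar>inner_vec n x y\<bar> \<le> norm_vec n x * norm_vec n y"
proof -
  have "\<bar>inner_vec n x y\<bar> \<le> (\<Sum>k<n. \<bar>x k\<bar> * \<bar>y k\<bar>)"
    unfolding inner_vec_def by (rule order_trans[OF sum_abs]) (simp add: abs_mult)
  also have "\<dots> \<le> norm_vec n x * norm_vec n y"
    unfolding norm_vec_def by (rule L2_set_mult_ineq)
  finally show ?thesis .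
qed

lemma abs_rho_le_1: "\<bar>rho n x y\<bar> \<le> 1"
proof (cases "norm_vec n x * norm_vec n y = 0")
  case False
  then have "0 < norm_vec n x * norm_vec n y"
    using norm_vec_nonneg[of n x] norm_vec_nonneg[of n y] by (simp add: less_le)
  then show ?thesis
    using abs_inner_vec_le[of n x y] by (simp only: rho_def abs_divide abs_of_pos divide_le_eq_1_pos)
qed (auto simp: rho_def)

lemma rho_commute: "rho n x y = rho n y x"
  by (simp add: rho_def inner_vec_def mult.commute)

lemma inner_vec_measurable[measurable]:
  assumes "f \<in> measurable L (euclid n)" "g \<in> measurable L (euclid n)"
  shows "(\<lambda>\<omega>. inner_vec n (f \<omega>) (g \<omega>)) \<in> borel_measurable L"
  unfolding inner_vec_def
  by (intro borel_measurable_sum borel_measurable_times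
      measurable_compose[OF assms(1)] measurable_compose[OF assms(2)] measurable_component_singleton) auto

lemma norm_vec_measurable[measurable]:
  assumes "f \<in> measurable L (euclid n)"
  shows "(\<lambda>\<omega>. norm_vec n (f \<omega>)) \<in> borel_measurable L"
proof -
  have "norm_vec n x = sqrt (inner_vec n x x)" for x
    by (simp add: inner_vec_self norm_vec_nonneg)
  then show ?thesis using assms by simp
qed

lemma rho_measurable[measurable]:
  assumes "f \<in> measurable L (euclid n)" "g \<in> measurable L (euclid n)"
  shows "(\<lambda>\<omega>. rho n (f \<omega>) (g \<omega>)) \<in> borel_measurable L"
  unfolding rho_def using assms by measurable

lemma inner_vec_diff_left: "inner_vec n (\<lambda>k. x k - y k) z = inner_vec n x z - inner_vec n y z"
  by (simp add: inner_vec_def left_diff_distrib sum_subtractf)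

lemma inner_vec_diff_right: "inner_vec n z (\<lambda>k. x k - y k) = inner_vec n z x - inner_vec n z y"
  by (simp add: inner_vec_def right_diff_distrib sum_subtractf)

lemma inner_vec_commute: "inner_vec n x y = inner_vec n y x"
  by (simp add: inner_vec_def mult.commute)

text \<open>The matrix of the reflection in the hyperplane orthogonal to \<open>w\<close>. When \<open>w\<close> vanishes, the
convention \<open>2 / 0 = 0\<close> makes this the identity matrix, so it is orthogonal for every \<open>w\<close>.\<close>

definition householder :: "nat \<Rightarrow> (nat \<Rightarrow> real) \<Rightarrow> nat \<Rightarrow> nat \<Rightarrow> real" where
  "householder n w = (\<lambda>i j. (if i = j then 1 else 0) - 2 / inner_vec n w w * w i * w j)"

lemma householder_sym: "householder n w i j = householder n w j i"
  by (simp add: householder_def)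

lemma householder_apply:
  assumes "i < n"
  shows "(\<Sum>k<n. householder n w i k * x k) = x i - 2 / inner_vec n w w * inner_vec n w x * w i"
proof -
  define c where "c = 2 / inner_vec n w w"
  have "(\<Sum>k<n. householder n w i k * x k) =
     (\<Sum>k<n. (if i = k then x k else 0)) - (\<Sum>k<n. (c * w i) * (w k * x k))"
    unfolding sum_subtractf[symmetric]
    by (intro sum.cong) (auto simp: householder_def c_def[symmetric] algebra_simps)
  also have "\<dots> = x i - c * w i * inner_vec n w x"
    using assms by (simp only: inner_vec_def sum_distrib_left[symmetric]) simp
  finally show ?thesis by (simp add: c_def mult_ac)
qed

lemma orthogonal_householder: "orthogonal_mat n (householder n w)"
proof -
  have *: "(\<Sum>k<n. householder n w i k * householder n w j k) = (if i = j then 1 else 0)"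
    if "i < n" "j < n" for i j
  proof -
    let ?c = "2 / inner_vec n w w"
    have "inner_vec n w (householder n w j) = w j - ?c * inner_vec n w w * w j"
      using householder_apply[OF that(2), of w w] by (simp add: inner_vec_def mult.commute)
    then have "(\<Sum>k<n. householder n w i k * householder n w j k) =
        householder n w j i - ?c * (w j - ?c * inner_vec n w w * w j) * w i"
      using householder_apply[OF that(1), of w "householder n w j"] by simp
    also have "\<dots> = (if i = j then 1 else 0)"
      by (cases "inner_vec n w w = 0") (auto simp: householder_def field_simps)
    finally show ?thesis .
  qed
  show ?thesis
    unfolding orthogonal_mat_def
    using * by (subst householder_sym, subst (2) householder_sym) blast
qed

lemma norm_mat_vec_orthogonal:
  assumes "orthogonal_mat n Q"
  shows "norm_vec n (mat_vec n Q x) = norm_vec n x"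
proof -
  have "inner_vec n (mat_vec n Q x) (mat_vec n Q x) =
      (\<Sum>i<n. \<Sum>k<n. \<Sum>l<n. Q i k * x k * (Q i l * x l))"
    unfolding inner_vec_def mat_vec_def by (intro sum.cong) (auto simp: sum_product)
  also have "\<dots> = (\<Sum>k<n. \<Sum>l<n. \<Sum>i<n. Q i k * x k * (Q i l * x l))"
    by (subst sum.swap, intro sum.cong refl sum.swap)
  also have "\<dots> = (\<Sum>k<n. \<Sum>l<n. x k * x l * (\<Sum>i<n. Q i k * Q i l))"
    by (simp add: sum_distrib_left mult_ac)
  also have "\<dots> = (\<Sum>k<n. \<Sum>l<n. x k * x l * (if k = l then 1 else 0))"
    using assms by (intro sum.cong refl) (auto simp: orthogonal_mat_def)
  also have "\<dots> = inner_vec n x x"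
    by (simp add: inner_vec_def if_distrib cong: if_cong)
  finally have "(norm_vec n (mat_vec n Q x))\<^sup>2 = (norm_vec n x)\<^sup>2"
    by (simp add: inner_vec_self)
  then show ?thesis
    by (simp add: norm_vec_nonneg)
qed

text \<open>The reflection along \<open>u - v\<close> exchanges \<open>u\<close> and \<open>v\<close> when they have the same length, which makes
the transitivity of the orthogonal group on spheres explicit. The image of \<open>u\<close> is moved here to the
other side of the inner product, since a reflection is symmetric.\<close>

lemma householder_transports:
  assumes "norm_vec n u = norm_vec n v"
  shows "inner_vec n u (mat_vec n (householder n (\<lambda>k. u k - v k)) x) = inner_vec n v x"
proof -
  define w where "w = (\<lambda>k. u k - v k)"
  define c where "c = 2 / inner_vec n w w"
  (* equality of the two norms: both sides are 2 |u|^2 - 2 <u, v> *)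
  have ww: "inner_vec n w w = 2 * inner_vec n w u"
    using assms inner_vec_commute[of n u v]
    by (simp add: w_def inner_vec_diff_left inner_vec_diff_right inner_vec_self)
  have "inner_vec n u (mat_vec n (householder n w) x) =
      (\<Sum>i<n. u i * (x i - c * inner_vec n w x * w i))"
    unfolding inner_vec_def[of n u] mat_vec_def by (intro sum.cong) (auto simp: householder_apply c_def)
  also have "\<dots> = (\<Sum>i<n. u i * x i) - (\<Sum>i<n. (c * inner_vec n w x) * (w i * u i))"
    by (simp add: right_diff_distrib sum_subtractf mult_ac)
  also have "\<dots> = inner_vec n u x - c * inner_vec n w x * inner_vec n w u"
    by (simp only: inner_vec_def sum_distrib_left[symmetric])
  also have "\<dots> = inner_vec n v x"
  proof (cases "inner_vec n w w = 0")
    case True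
    then have "\<forall>k<n. w k = 0" by (simp add: inner_vec_self norm_vec_eq_0_iff)
    then have "inner_vec n u x = inner_vec n v x"
      unfolding inner_vec_def w_def by (intro sum.cong) auto
    with True show ?thesis by (simp add: c_def)
  next
    case False
    then have "c * inner_vec n w x * inner_vec n w u = inner_vec n w x" by (simp add: c_def ww)
    moreover have "inner_vec n w x = inner_vec n u x - inner_vec n v x"
      by (simp add: w_def inner_vec_diff_left)
    ultimately show ?thesis by linarith
  qed
  finally show ?thesis by (simp add: w_def)
qed

lemma mat_vec_measurable:
  "mat_vec n Q \<in> measurable (euclid n) (euclid n)"
  unfolding mat_vec_def
  by (intro measurable_restrict borel_measurable_sum borel_measurable_times
       measurable_component_singleton) auto

text \<open>For a spherical vector, the joint law of an inner product \<open>\<langle>u, Y\<rangle>\<close> and of \<open>\<parallel>Y\<parallel>\<close> depends on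
\<open>u\<close> through its norm alone: an orthogonal map carries one direction to the other and preserves
\<open>\<parallel>Y\<parallel>\<close>.\<close>

lemma spherical_expectation_direction:
  fixes g :: "real \<Rightarrow> real \<Rightarrow> real"
  assumes "spherical M n Y" and "norm_vec n u = norm_vec n v"
    and u: "u \<in> space (euclid n)" and v: "v \<in> space (euclid n)"
    and g[measurable]: "case_prod g \<in> borel_measurable (borel \<Otimes>\<^sub>M borel)"
  shows "(\<integral>\<omega>. g (inner_vec n u (Y \<omega>)) (norm_vec n (Y \<omega>)) \<partial>M) =
         (\<integral>\<omega>. g (inner_vec n v (Y \<omega>)) (norm_vec n (Y \<omega>)) \<partial>M)"
proof -
  have Y[measurable]: "Y \<in> measurable M (euclid n)" using assms by (simp add: spherical_def)
  note mat_vec_measurable[measurable]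
  let ?Q = "householder n (\<lambda>k. u k - v k)"
  have D: "distr M (euclid n) (\<lambda>\<omega>. mat_vec n ?Q (Y \<omega>)) = distr M (euclid n) Y"
    using assms orthogonal_householder by (auto simp: spherical_def)
  have gm: "(\<lambda>x. g (inner_vec n u x) (norm_vec n x)) \<in> borel_measurable (euclid n)"
    using u by measurable
  have "(\<integral>\<omega>. g (inner_vec n u (Y \<omega>)) (norm_vec n (Y \<omega>)) \<partial>M) =
      (\<integral>x. g (inner_vec n u x) (norm_vec n x) \<partial>distr M (euclid n) Y)"
    using gm by (subst integral_distr[OF Y]) auto
  also have "\<dots> = (\<integral>x. g (inner_vec n u x) (norm_vec n x) \<partial>distr M (euclid n) (\<lambda>\<omega>. mat_vec n ?Q (Y \<omega>)))"
    by (simp only: D)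
  also have "\<dots> = (\<integral>\<omega>. g (inner_vec n u (mat_vec n ?Q (Y \<omega>))) (norm_vec n (mat_vec n ?Q (Y \<omega>))) \<partial>M)"
    using gm by (subst integral_distr) auto
  also have "\<dots> = (\<integral>\<omega>. g (inner_vec n v (Y \<omega>)) (norm_vec n (Y \<omega>)) \<partial>M)"
    using assms by (simp add: householder_transports norm_mat_vec_orthogonal orthogonal_householder)
  finally show ?thesis .
qed

section \<open>The law of the squared correlation with a fixed direction\<close>

lemma coeff_2_power_one_plus_square: "poly.coeff ([:1, 0, 1:] ^ K) 2 = (real K :: real)"
proof -
  have "poly.coeff ([:1, 0, 1:] ^ K :: real poly) 0 = 1 \<and> poly.coeff ([:1, 0, 1:] ^ K) 2 = (real K :: real)"
    by (induction K) (auto simp: numeral_2_eq_2 coeff_pCons)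
  then show ?thesis by simp
qed

text \<open>The heart of the computation of the moments. Both sides of the isotropy assumption are
polynomials in \<open>t\<close>, so their coefficients of \<open>t\<^sup>2\<close> agree. On the left this is a multiple of the
mixed moment of \<open>V\<^sub>j\<^sup>2 V\<^sub>0\<^bsup>2k\<^esup>\<close>, on the right a multiple of the next moment of \<open>V\<^sub>0\<close>; and the
mixed moments, together with the one for \<open>j = 0\<close>, add up to the moment of order \<open>2k\<close> because
\<open>V\<close> is a unit vector.\<close>

lemma (in prob_space) moment_recursion:
  fixes V :: "nat \<Rightarrow> 'a \<Rightarrow> real"
  assumes V[measurable]: "\<And>i. i < n \<Longrightarrow> V i \<in> borel_measurable M"
    and bound: "\<And>i \<omega>. i < n \<Longrightarrow> \<bar>V i \<omega>\<bar> \<le> 1"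
    and unit: "AE \<omega> in M. (\<Sum>i<n. (V i \<omega>)\<^sup>2) = 1"
    and iso: "\<And>j t. 0 < j \<Longrightarrow> j < n \<Longrightarrow>
        expectation (\<lambda>\<omega>. (V 0 \<omega> + t * V j \<omega>) ^ (2 * Suc k)) =
        (1 + t\<^sup>2) ^ Suc k * expectation (\<lambda>\<omega>. V 0 \<omega> ^ (2 * Suc k))"
    and n: "0 < n"
  shows "(real n + 2 * real k) * expectation (\<lambda>\<omega>. V 0 \<omega> ^ (2 * Suc k)) =
         (2 * real k + 1) * expectation (\<lambda>\<omega>. V 0 \<omega> ^ (2 * k))"
proof -
  let ?K = "2 * Suc k"
  define m where "m = expectation (\<lambda>\<omega>. V 0 \<omega> ^ ?K)"
  have int: "integrable M (\<lambda>\<omega>. V j \<omega> ^ a * V 0 \<omega> ^ b)" if "j < n" for j a b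
  proof (rule integrable_const_bound[where B=1])
    show "AE \<omega> in M. norm (V j \<omega> ^ a * V 0 \<omega> ^ b) \<le> 1"
      using bound[OF that] bound[OF n]
      by (intro AE_I2) (simp add: abs_mult power_abs mult_le_one power_le_one)
    show "(\<lambda>\<omega>. V j \<omega> ^ a * V 0 \<omega> ^ b) \<in> borel_measurable M" using that n by measurable
  qed
  have mixed: "(2 * real k + 1) * expectation (\<lambda>\<omega>. (V j \<omega>)\<^sup>2 * V 0 \<omega> ^ (2 * k)) = m"
    if j: "0 < j" "j < n" for j
  proof -
    define c where "c = (\<lambda>i. real (?K choose i) * expectation (\<lambda>\<omega>. V j \<omega> ^ i * V 0 \<omega> ^ (?K - i)))"
    define P where "P = (\<Sum>i\<le>?K. monom (c i) i)"
    have "poly P t = poly (smult m ([:1, 0, 1:] ^ Suc k)) t" for t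
    proof -
      have "(V 0 \<omega> + t * V j \<omega>) ^ ?K =
          (\<Sum>i\<le>?K. real (?K choose i) * t ^ i * (V j \<omega> ^ i * V 0 \<omega> ^ (?K - i)))" for \<omega>
        by (subst add.commute, subst binomial_ring) (simp add: power_mult_distrib mult_ac)
      then have "expectation (\<lambda>\<omega>. (V 0 \<omega> + t * V j \<omega>) ^ ?K) = (\<Sum>i\<le>?K. c i * t ^ i)"
        unfolding c_def by (simp only:, subst Bochner_Integration.integral_sum)
          (use int[OF j(2)] in \<open>auto intro!: integrable_mult_right sum.cong simp del: power_Suc\<close>)
      also have "\<dots> = poly P t" by (simp add: P_def poly_sum poly_monom)
      finally show ?thesis
        using iso[OF j, of t]
        by (simp add: m_def poly_power power2_eq_square algebra_simps del: power_Suc mult_Suc_right)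
    qed
    (* two polynomial functions of t that agree everywhere have the same coefficients *)
    then have "P = smult m ([:1, 0, 1:] ^ Suc k)" by (intro poly_ext) auto
    then have "poly.coeff P 2 = m * real (Suc k)"
      by (simp add: coeff_2_power_one_plus_square del: power_Suc)
    moreover have "poly.coeff P 2 = c 2"
      unfolding P_def coeff_sum coeff_monom by (subst sum.delta) auto
    moreover have "c 2 = real (Suc k) * ((2 * real k + 1) * expectation (\<lambda>\<omega>. (V j \<omega>)\<^sup>2 * V 0 \<omega> ^ (2 * k)))"
    proof -
      have "?K choose 2 = Suc k * (2 * k + 1)"
        by (simp add: choose_two algebra_simps)
      then show ?thesis unfolding c_def by (simp add: algebra_simps)
    qed
    ultimately show ?thesis by simp
  qed
  have "expectation (\<lambda>\<omega>. V 0 \<omega> ^ (2 * k)) = expectation (\<lambda>\<omega>. \<Sum>i<n. (V i \<omega>)\<^sup>2 * V 0 \<omega> ^ (2 * k))"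
  proof (rule integral_cong_AE)
    show "AE \<omega> in M. V 0 \<omega> ^ (2 * k) = (\<Sum>i<n. (V i \<omega>)\<^sup>2 * V 0 \<omega> ^ (2 * k))"
      using unit by eventually_elim (simp add: sum_distrib_right[symmetric])
  qed (use n in measurable)
  also have "\<dots> = (\<Sum>i<n. expectation (\<lambda>\<omega>. (V i \<omega>)\<^sup>2 * V 0 \<omega> ^ (2 * k)))"
    using int by (intro Bochner_Integration.integral_sum) auto
  also have "{..<n} = insert 0 {1..<n}" using n by auto
  also have "(\<Sum>i\<in>insert 0 {1..<n}. expectation (\<lambda>\<omega>. (V i \<omega>)\<^sup>2 * V 0 \<omega> ^ (2 * k))) =
      m + (\<Sum>i\<in>{1..<n}. expectation (\<lambda>\<omega>. (V i \<omega>)\<^sup>2 * V 0 \<omega> ^ (2 * k)))"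
    by (simp add: m_def power2_eq_square mult.assoc)
  finally have "(2 * real k + 1) * expectation (\<lambda>\<omega>. V 0 \<omega> ^ (2 * k)) =
      (2 * real k + 1) * m + (\<Sum>i\<in>{1..<n}. (2 * real k + 1) * expectation (\<lambda>\<omega>. (V i \<omega>)\<^sup>2 * V 0 \<omega> ^ (2 * k)))"
    by (simp only: distrib_left sum_distrib_left)
  also have "(\<Sum>i\<in>{1..<n}. (2 * real k + 1) * expectation (\<lambda>\<omega>. (V i \<omega>)\<^sup>2 * V 0 \<omega> ^ (2 * k))) =
      (\<Sum>i\<in>{1..<n}. m)"
    by (intro sum.cong mixed) auto
  also have "(2 * real k + 1) * m + (\<Sum>i\<in>{1..<n}. m) = (real n + 2 * real k) * m"
    using n by (simp add: of_nat_diff algebra_simps)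
  finally show ?thesis by (simp add: m_def)
qed

text \<open>Equal moments give equal integrals of polynomials, hence by the Weierstrass theorem of all
continuous functions, in particular of the piecewise linear functions that interpolate between
indicators of half-lines; right-continuity then identifies the distribution functions.\<close>

lemma real_distribution_eqI_moments:
  assumes M: "real_distribution M" and N: "real_distribution N"
    and M01: "AE x in M. x \<in> {0..1}" and N01: "AE x in N. x \<in> {0..1}"
    and moments: "\<And>k. (\<integral>x. x ^ k \<partial>M) = (\<integral>x. x ^ k \<partial>N)"
  shows "M = N"
proof -
  have int: "integrable L f"
    if L: "real_distribution L" "AE x in L. x \<in> {0..1}" and f: "continuous_on UNIV f" for L and f :: "real \<Rightarrow> real"
  proof -
    interpret real_distribution L by (rule L)
    have "compact (f ` {0..1})"
      using f by (intro compact_continuous_image) (auto intro: continuous_on_subset)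
    then obtain B where B: "\<And>x. x \<in> {0..1} \<Longrightarrow> norm (f x) \<le> B"
      by (metis (mono_tags, lifting) bounded_iff compact_imp_bounded imageI)
    have "f \<in> borel_measurable L" using f by (simp add: borel_measurable_continuous_onI)
    moreover have "AE x in L. norm (f x) \<le> B"
      using L(2) by eventually_elim (rule B)
    ultimately show ?thesis by (rule integrable_const_bound[rotated])
  qed
  have poly: "(\<integral>x. g x \<partial>M) = (\<integral>x. g x \<partial>N)" if "real_polynomial_function g" for g :: "real \<Rightarrow> real"
  proof -
    obtain a n where g: "g = (\<lambda>x. \<Sum>i\<le>n. a i * x ^ i)"
      using \<open>real_polynomial_function g\<close> by (auto simp: real_polynomial_function_iff_sum)
    have "(\<integral>x. g x \<partial>L) = (\<Sum>i\<le>n. a i * (\<integral>x. x ^ i \<partial>L))"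
      if "real_distribution L" "AE x in L. x \<in> {0..1}" for L
      unfolding g
      by (subst Bochner_Integration.integral_sum) (auto intro!: int[OF that] continuous_intros)
    then show ?thesis using assms by simp
  qed
  have cont: "(\<integral>x. f x \<partial>M) = (\<integral>x. f x \<partial>N)" if f: "continuous_on UNIV f" for f :: "real \<Rightarrow> real"
  proof (rule ccontr)
    define d where "d = \<bar>(\<integral>x. f x \<partial>M) - (\<integral>x. f x \<partial>N)\<bar>"
    assume "(\<integral>x. f x \<partial>M) \<noteq> (\<integral>x. f x \<partial>N)"
    then have "0 < d / 3" by (simp add: d_def)
    moreover have "continuous_on {0..1} f" using f by (auto intro: continuous_on_subset)
    ultimately obtain g where g: "real_polynomial_function g" and
      fg: "\<And>x. x \<in> {0..1} \<Longrightarrow> \<bar>f x - g x\<bar> < d / 3"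
      using Stone_Weierstrass_real_polynomial_function[of "{0..1::real}" f "d / 3"] by auto
    have g_cont: "continuous_on UNIV g"
      using g by (auto simp: real_polynomial_function_iff_sum intro!: continuous_intros)
    have approx: "\<bar>(\<integral>x. f x \<partial>L) - (\<integral>x. g x \<partial>L)\<bar> \<le> d / 3"
      if L: "real_distribution L" "AE x in L. x \<in> {0..1}" for L
    proof -
      interpret real_distribution L by (rule L)
      have "\<bar>(\<integral>x. f x \<partial>L) - (\<integral>x. g x \<partial>L)\<bar> = \<bar>\<integral>x. f x - g x \<partial>L\<bar>"
        using int[OF L f] int[OF L g_cont] by simp
      also have "\<dots> \<le> (\<integral>x. \<bar>f x - g x\<bar> \<partial>L)" by (rule integral_abs_bound)
      also have "\<dots> \<le> (\<integral>x. d / 3 \<partial>L)"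
      proof (rule integral_mono_AE)
        show "AE x in L. \<bar>f x - g x\<bar> \<le> d / 3"
          using L(2) by eventually_elim (use fg in force)
      qed (use int[OF L f] int[OF L g_cont] in auto)
      also have "\<dots> = d / 3" using prob_space by simp
      finally show ?thesis .
    qed
    have "d = \<bar>((\<integral>x. f x \<partial>M) - (\<integral>x. g x \<partial>M)) - ((\<integral>x. f x \<partial>N) - (\<integral>x. g x \<partial>N))\<bar>"
      unfolding d_def poly[OF g] by simp
    also have "\<dots> \<le> d / 3 + d / 3"
      by (rule order_trans[OF abs_triangle_ineq4 add_mono[OF approx[OF M M01] approx[OF N N01]]])
    finally show False using \<open>0 < d / 3\<close> by simp
  qed
  have le: "cdf L x \<le> cdf L' x"
    if L: "real_distribution L" and L': "real_distribution L'"
      and eq: "\<And>f :: real \<Rightarrow> real. continuous_on UNIV f \<Longrightarrow> (\<integral>x. f x \<partial>L) = (\<integral>x. f x \<partial>L')" for L L' x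
  proof -
    interpret L: real_distribution L by (rule L)
    interpret L': real_distribution L' by (rule L')
    have step: "cdf L x \<le> cdf L' y" if "x < y" for y
    proof -
      have "cdf L x \<le> integral\<^sup>L L (cts_step x y)" using that by (rule L.cdf_cts_step)
      also have "\<dots> = integral\<^sup>L L' (cts_step x y)"
        using cts_step_uniformly_continuous[OF that]
        by (intro eq uniformly_continuous_imp_continuous)
      also have "\<dots> \<le> cdf L' y" using that by (rule L'.cdf_cts_step)
      finally show ?thesis .
    qed
    have "(cdf L' \<longlongrightarrow> cdf L' x) (at_right x)"
      using L'.cdf_is_right_cont by (simp add: continuous_within)
    then show ?thesis
    proof (rule tendsto_lowerbound)
      show "\<forall>\<^sub>F y in at_right x. cdf L x \<le> cdf L' y"
        using eventually_at_right_less[of x] by eventually_elim (rule step)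
    qed simp
  qed
  have "cdf M = cdf N"
    by (intro ext antisym le M N cont cont[symmetric])
  then show ?thesis by (rule cdf_unique[OF M N])
qed

definition beta_density :: "real \<Rightarrow> real \<Rightarrow> real \<Rightarrow> real" where
  "beta_density a b x = indicator {0..1} x * (x powr (a - 1) * (1 - x) powr (b - 1)) / Beta a b"

definition beta_distr :: "real \<Rightarrow> real \<Rightarrow> real measure" where
  "beta_distr a b = density lborel (\<lambda>x. ennreal (beta_density a b x))"

lemma Beta_pos: "0 < a \<Longrightarrow> 0 < b \<Longrightarrow> 0 < Beta a (b :: real)"
  by (simp add: Beta_def Gamma_real_pos rGamma_inverse_Gamma)

lemma beta_density_nonneg: "0 < a \<Longrightarrow> 0 < b \<Longrightarrow> 0 \<le> beta_density a b x"
  using Beta_pos[of a b] by (simp add: beta_density_def)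

lemma beta_density_measurable[measurable]: "beta_density a b \<in> borel_measurable borel"
  unfolding beta_density_def[abs_def] by measurable

lemma has_bochner_integral_beta_density_power:
  assumes "0 < a" "0 < b"
  shows "has_bochner_integral lborel (\<lambda>x. x ^ k * beta_density a b x) (Beta (a + real k) b / Beta a b)"
proof -
  define f where "f = (\<lambda>x::real. x ^ k * beta_density a b x)"
  have f_eq: "f x = indicator {0..1} x * (x powr (a + real k - 1) * (1 - x) powr (b - 1) / Beta a b)" for x
  proof (cases "0 < x")
    case True
    then have "x ^ k * x powr (a - 1) = x powr (a + real k - 1)"
      by (simp add: powr_realpow[symmetric] powr_add[symmetric] algebra_simps)
    then show ?thesis
      by (simp add: f_def beta_density_def mult_ac split: split_indicator)
  qed (cases "x = 0"; simp add: f_def beta_density_def)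
  have nonneg: "0 \<le> f x" for x
    using Beta_pos[OF assms] by (simp add: f_eq)
  have "((\<lambda>x. x powr (a + real k - 1) * (1 - x) powr (b - 1) / Beta a b) has_integral
      Beta (a + real k) b / Beta a b) {0..1}"
    using assms by (intro has_integral_divide has_integral_Beta_real) auto
  from nn_integral_has_integral_lebesgue[OF _ this]
  have "(\<integral>\<^sup>+x. ennreal (f x) \<partial>lborel) = ennreal (Beta (a + real k) b / Beta a b)"
    using Beta_pos[OF assms] unfolding f_eq by simp
  then have "has_bochner_integral lborel f (Beta (a + real k) b / Beta a b)"
    using nonneg Beta_pos[of a b] Beta_pos[of "a + real k" b] assms
    by (intro has_bochner_integral_nn_integral) (auto simp: f_def)
  then show ?thesis by (simp add: f_def)
qed

lemma real_distribution_beta: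
  assumes "0 < a" "0 < b"
  shows "real_distribution (beta_distr a b)"
proof -
  have "has_bochner_integral lborel (beta_density a b) 1"
    using has_bochner_integral_beta_density_power[OF assms, of 0] Beta_pos[OF assms] by simp
  then have "(\<integral>\<^sup>+x. ennreal (beta_density a b x) \<partial>lborel) = 1"
    using beta_density_nonneg[OF assms]
    by (subst nn_integral_eq_integral) (auto simp: has_bochner_integral_iff)
  then have "prob_space (beta_distr a b)"
    unfolding beta_distr_def by (intro prob_spaceI) (simp add: emeasure_density)
  then show ?thesis
    by (simp add: real_distribution_def real_distribution_axioms_def beta_distr_def)
qed

lemma beta_distr_moment:
  assumes "0 < a" "0 < b"
  shows "(\<integral>x. x ^ k \<partial>beta_distr a b) = Beta (a + real k) b / Beta a b"
  using has_bochner_integral_beta_density_power[OF assms, of k]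
  unfolding beta_distr_def
  by (subst integral_density) (auto simp: beta_density_nonneg[OF assms] has_bochner_integral_iff mult.commute)

lemma beta_distr_support:
  "AE x in beta_distr a b. x \<in> {0..1}"
  unfolding beta_distr_def
  by (subst AE_density) (auto simp: beta_density_def split: split_indicator_asm)

lemma (in prob_space) AE_norm_vec_nonzero:
  assumes [measurable]: "Y \<in> measurable M (euclid n)"
    and nz: "prob {\<omega> \<in> space M. \<forall>k<n. Y \<omega> k = 0} = 0"
  shows "AE \<omega> in M. norm_vec n (Y \<omega>) \<noteq> 0"
proof -
  have "{\<omega> \<in> space M. norm_vec n (Y \<omega>) = 0} \<in> events" by measurable
  then show ?thesis
    using nz
    by (subst AE_iff_measurable[of "{\<omega> \<in> space M. norm_vec n (Y \<omega>) = 0}"])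
      (auto simp: norm_vec_eq_0_iff emeasure_eq_measure)
qed

text \<open>Both laws live on \<open>[0, 1]\<close>, and their moments satisfy the same recursion: on one side by
\<open>moment_recursion\<close>, on the other by \<open>(a + b) B(a + 1, b) = a B(a, b)\<close> with \<open>a = 1/2 + k\<close> and
\<open>a + b = n/2 + k\<close>.\<close>

lemma spherical_rho_square_distr:
  assumes "prob_space M" and sph: "spherical M n Y" and n: "2 \<le> n"
    and nz: "measure M {\<omega> \<in> space M. \<forall>k<n. Y \<omega> k = 0} = 0"
    and x: "x \<in> space (euclid n)" "norm_vec n x \<noteq> 0"
  shows "distr M borel (\<lambda>\<omega>. (rho n x (Y \<omega>))\<^sup>2) = beta_distr (1 / 2) ((real n - 1) / 2)"
proof -
  interpret prob_space M by fact
  have Y[measurable]: "Y \<in> measurable M (euclid n)" using sph by (simp add: spherical_def)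
  define b where "b = (real n - 1) / 2"
  have b: "0 < b" using n by (simp add: b_def)
  define V where "V = (\<lambda>i \<omega>. Y \<omega> i / norm_vec n (Y \<omega>))"
  have Y_i: "(\<lambda>\<omega>. Y \<omega> i) \<in> borel_measurable M" if "i < n" for i
    using that by (intro measurable_compose[OF Y] measurable_component_singleton) auto
  then have V_meas: "V i \<in> borel_measurable M" if "i < n" for i
    unfolding V_def using that by measurable
  have V_bound: "\<bar>V i \<omega>\<bar> \<le> 1" if "i < n" for i \<omega>
  proof -
    have "\<bar>Y \<omega> i\<bar> \<le> norm_vec n (Y \<omega>)"
      using member_le_L2_set[of "{..<n}" i "\<lambda>k. \<bar>Y \<omega> k\<bar>"] that by (simp add: norm_vec_def L2_set_def)
    then show ?thesis
      using norm_vec_nonneg[of n "Y \<omega>"] by (auto simp: V_def divide_le_eq_1 abs_divide less_le)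
  qed
  have nonzero: "AE \<omega> in M. norm_vec n (Y \<omega>) \<noteq> 0"
    using Y nz by (rule AE_norm_vec_nonzero)
  have unit: "AE \<omega> in M. (\<Sum>i<n. (V i \<omega>)\<^sup>2) = 1"
    using nonzero
  proof eventually_elim
    case (elim \<omega>)
    have "(\<Sum>i<n. (V i \<omega>)\<^sup>2) = inner_vec n (Y \<omega>) (Y \<omega>) / (norm_vec n (Y \<omega>))\<^sup>2"
      by (simp add: V_def inner_vec_def sum_divide_distrib power_divide power2_eq_square)
    then show ?case using elim by (simp add: inner_vec_self)
  qed
  have direction: "expectation (\<lambda>\<omega>. (inner_vec n u (Y \<omega>) / norm_vec n (Y \<omega>)) ^ (2 * k)) =
      norm_vec n u ^ (2 * k) * expectation (\<lambda>\<omega>. V 0 \<omega> ^ (2 * k))"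
    if u: "u \<in> space (euclid n)" for u k
  proof -
    (* the multiple of the first unit vector with the same length as u *)
    define v where "v = (\<lambda>i\<in>{..<n}. if i = 0 then norm_vec n u else 0)"
    have inner_v: "inner_vec n v y = norm_vec n u * y 0" for y
    proof -
      have "inner_vec n v y = (\<Sum>i<n. if i = 0 then norm_vec n u * y i else 0)"
        unfolding inner_vec_def v_def by (intro sum.cong) auto
      then show ?thesis using n by (simp add: sum.delta)
    qed
    have "(norm_vec n v)\<^sup>2 = (norm_vec n u)\<^sup>2"
      unfolding inner_vec_self[symmetric] inner_v using n by (simp add: v_def power2_eq_square inner_vec_self)
    then have norm_v: "norm_vec n u = norm_vec n v" by (simp add: norm_vec_nonneg)
    have "expectation (\<lambda>\<omega>. (inner_vec n u (Y \<omega>) / norm_vec n (Y \<omega>)) ^ (2 * k)) =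
        expectation (\<lambda>\<omega>. (inner_vec n v (Y \<omega>) / norm_vec n (Y \<omega>)) ^ (2 * k))"
      by (rule spherical_expectation_direction[OF sph norm_v u, where g="\<lambda>a r. (a / r) ^ (2 * k)"])
        (auto simp: v_def space_PiM)
    also have "\<dots> = expectation (\<lambda>\<omega>. norm_vec n u ^ (2 * k) * V 0 \<omega> ^ (2 * k))"
      by (simp add: inner_v V_def power_mult_distrib power_divide)
    finally show ?thesis by simp
  qed
  have iso: "expectation (\<lambda>\<omega>. (V 0 \<omega> + t * V j \<omega>) ^ (2 * Suc k)) =
        (1 + t\<^sup>2) ^ Suc k * expectation (\<lambda>\<omega>. V 0 \<omega> ^ (2 * Suc k))" if j: "0 < j" "j < n" for j t k
  proof -
    define u where "u = (\<lambda>i\<in>{..<n}. if i = 0 then 1 else if i = j then t else 0)"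
    have inner_u: "inner_vec n u y = y 0 + t * y j" for y
    proof -
      have "inner_vec n u y = (\<Sum>i<n. (if i = 0 then y i else 0) + (if i = j then t * y i else 0))"
        unfolding inner_vec_def u_def using j by (intro sum.cong) auto
      then show ?thesis using j n by (simp add: sum.distrib sum.delta)
    qed
    have "(norm_vec n u)\<^sup>2 = 1 + t\<^sup>2"
      unfolding inner_vec_self[symmetric] inner_u using j n by (simp add: u_def power2_eq_square)
    then have "norm_vec n u ^ (2 * Suc k) = (1 + t\<^sup>2) ^ Suc k"
      by (simp only: power_mult)
    moreover have "inner_vec n u (Y \<omega>) / norm_vec n (Y \<omega>) = V 0 \<omega> + t * V j \<omega>" for \<omega>
      by (simp add: inner_u V_def add_divide_distrib)
    moreover have "u \<in> space (euclid n)" by (simp add: u_def space_PiM)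
    ultimately show ?thesis using direction[of u "Suc k"] by simp
  qed
  have moment: "expectation (\<lambda>\<omega>. V 0 \<omega> ^ (2 * k)) = Beta (1 / 2 + real k) b / Beta (1 / 2) b" for k
  proof (induction k)
    case 0
    have "Beta (1 / 2) b \<noteq> 0" using Beta_pos[of "1 / 2" b] b by simp
    then show ?case by (simp add: prob_space)
  next
    case (Suc k)
    have "(real n + 2 * real k) * expectation (\<lambda>\<omega>. V 0 \<omega> ^ (2 * Suc k)) =
         (2 * real k + 1) * expectation (\<lambda>\<omega>. V 0 \<omega> ^ (2 * k))"
      using n by (intro moment_recursion V_meas V_bound unit iso) auto
    moreover have "(real n + 2 * real k) * Beta (1 / 2 + real (Suc k)) b =
        (2 * real k + 1) * Beta (1 / 2 + real k) b"
    proof -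
      have "1 / 2 + real k \<notin> \<int>\<^sub>\<le>\<^sub>0" by (auto elim!: nonpos_Ints_cases)
      from Beta_plus1_left[OF this, of b] show ?thesis
        by (simp add: b_def field_simps)
    qed
    moreover have "real n + 2 * real k > 0" using n by simp
    ultimately have "(real n + 2 * real k) * expectation (\<lambda>\<omega>. V 0 \<omega> ^ (2 * Suc k)) =
        (real n + 2 * real k) * (Beta (1 / 2 + real (Suc k)) b / Beta (1 / 2) b)"
      by (simp only: Suc.IH times_divide_eq_right)
    then show ?case using \<open>real n + 2 * real k > 0\<close> by (simp only: mult_left_cancel less_irrefl)
  qed
  show ?thesis
    unfolding b_def[symmetric]
  proof (rule real_distribution_eqI_moments)
    have R[measurable]: "(\<lambda>\<omega>. rho n x (Y \<omega>)) \<in> borel_measurable M"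
      using x by (intro rho_measurable) auto
    show "real_distribution (distr M borel (\<lambda>\<omega>. (rho n x (Y \<omega>))\<^sup>2))"
      by (intro real_distribution_distr) measurable
    show "real_distribution (beta_distr (1 / 2) b)" using b by (intro real_distribution_beta) auto
    show "AE x in beta_distr (1 / 2) b. x \<in> {0..1}" by (rule beta_distr_support)
    show "AE z in distr M borel (\<lambda>\<omega>. (rho n x (Y \<omega>))\<^sup>2). z \<in> {0..1}"
      by (subst AE_distr_iff) (auto simp: abs_square_le_1 abs_rho_le_1)
    fix k
    have "(\<integral>z. z ^ k \<partial>distr M borel (\<lambda>\<omega>. (rho n x (Y \<omega>))\<^sup>2)) = expectation (\<lambda>\<omega>. (rho n x (Y \<omega>)) ^ (2 * k))"
      by (subst integral_distr) (auto simp: power_mult)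
    also have "\<dots> = expectation (\<lambda>\<omega>. (inner_vec n x (Y \<omega>) / norm_vec n (Y \<omega>)) ^ (2 * k) / norm_vec n x ^ (2 * k))"
      by (simp add: rho_def power_divide power_mult_distrib mult.commute)
    also have "\<dots> = expectation (\<lambda>\<omega>. V 0 \<omega> ^ (2 * k))"
      using x direction[OF x(1), of k] by simp
    finally show "(\<integral>z. z ^ k \<partial>distr M borel (\<lambda>\<omega>. (rho n x (Y \<omega>))\<^sup>2)) = (\<integral>z. z ^ k \<partial>beta_distr (1 / 2) b)"
      using moment beta_distr_moment[of "1 / 2" b k] b by simp
  qed
qed

section \<open>Independent points under a symmetric relation\<close>

text \<open>Fubini in the form needed below: if almost every section of \<open>E\<close> has the same probability under \<open>V\<close>,
then the event \<open>(U, V) \<in> E\<close> is independent of \<open>U\<close>.\<close>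

lemma (in prob_space) prob_indep_section:
  assumes indep: "indep_var S U T V"
    and E: "E \<in> sets (S \<Otimes>\<^sub>M T)" and B: "B \<in> sets S"
    and q: "AE \<omega> in M. prob {\<omega>' \<in> space M. (U \<omega>, V \<omega>') \<in> E} = q"
  shows "prob {\<omega> \<in> space M. U \<omega> \<in> B \<and> (U \<omega>, V \<omega>) \<in> E} = q * prob {\<omega> \<in> space M. U \<omega> \<in> B}"
proof -
  have U[measurable]: "U \<in> measurable M S" and V[measurable]: "V \<in> measurable M T"
    and D: "distr M S U \<Otimes>\<^sub>M distr M T V = distr M (S \<Otimes>\<^sub>M T) (\<lambda>\<omega>. (U \<omega>, V \<omega>))"
    using indep by (auto simp: indep_var_distribution_eq)
  interpret V: prob_space "distr M T V" by (rule prob_space_distr[OF V])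
  note E[measurable] B[measurable]
  have q0: "0 \<le> q"
  proof -
    have "AE \<omega> in M. 0 \<le> q"
      using q by eventually_elim (metis measure_nonneg)
    then show ?thesis by simp
  qed
  let ?E = "E \<inter> (B \<times> space T)"
  have E': "?E \<in> sets (S \<Otimes>\<^sub>M T)" by measurable
  have sec: "emeasure (distr M T V) (Pair u -` ?E) =
      indicator B u * emeasure M {\<omega>' \<in> space M. (u, V \<omega>') \<in> E}" if "u \<in> space S" for u
  proof -
    have "Pair u -` ?E \<in> sets T" using E' by (rule sets_Pair1)
    then have "emeasure (distr M T V) (Pair u -` ?E) = emeasure M (V -` (Pair u -` ?E) \<inter> space M)"
      by (simp add: emeasure_distr)
    also have "V -` (Pair u -` ?E) \<inter> space M =
        (if u \<in> B then {\<omega>' \<in> space M. (u, V \<omega>') \<in> E} else {})"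
      using measurable_space[OF V] by auto
    finally show ?thesis by auto
  qed
  have "emeasure M {\<omega> \<in> space M. U \<omega> \<in> B \<and> (U \<omega>, V \<omega>) \<in> E} =
      emeasure (distr M (S \<Otimes>\<^sub>M T) (\<lambda>\<omega>. (U \<omega>, V \<omega>))) ?E"
    using E' measurable_space[OF V]
    by (subst emeasure_distr) (auto intro!: arg_cong[where f="emeasure M"])
  also have "\<dots> = emeasure (distr M S U \<Otimes>\<^sub>M distr M T V) ?E" by (simp add: D)
  also have "\<dots> = (\<integral>\<^sup>+u. emeasure (distr M T V) (Pair u -` ?E) \<partial>distr M S U)"
    using E' by (intro V.emeasure_pair_measure_alt) (simp cong: sets_pair_measure_cong)
  also have "\<dots> = (\<integral>\<^sup>+u. indicator B u * emeasure M {\<omega>' \<in> space M. (u, V \<omega>') \<in> E} \<partial>distr M S U)"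
    by (intro nn_integral_cong sec) simp
  also have "\<dots> = (\<integral>\<^sup>+\<omega>. indicator B (U \<omega>) * emeasure M {\<omega>' \<in> space M. (U \<omega>, V \<omega>') \<in> E} \<partial>M)"
  proof (rule nn_integral_distr[OF U])
    have "(\<lambda>u. emeasure M {\<omega>' \<in> space M. (u, V \<omega>') \<in> E}) \<in> borel_measurable S"
      by measurable
    then show "(\<lambda>u. indicator B u * emeasure M {\<omega>' \<in> space M. (u, V \<omega>') \<in> E}) \<in> borel_measurable (distr M S U)"
      by simp
  qed
  also have "\<dots> = (\<integral>\<^sup>+\<omega>. ennreal q * indicator {\<omega> \<in> space M. U \<omega> \<in> B} \<omega> \<partial>M)"
  proof (rule nn_integral_cong_AE)
    show "AE \<omega> in M. indicator B (U \<omega>) * emeasure M {\<omega>' \<in> space M. (U \<omega>, V \<omega>') \<in> E} =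
        ennreal q * indicator {\<omega> \<in> space M. U \<omega> \<in> B} \<omega>"
      using q AE_space by eventually_elim (auto simp: emeasure_eq_measure split: split_indicator)
  qed
  also have "\<dots> = ennreal q * emeasure M {\<omega> \<in> space M. U \<omega> \<in> B}"
    by (simp add: nn_integral_cmult)
  finally show ?thesis
    using q0 by (simp add: emeasure_eq_measure ennreal_mult[symmetric])
qed

text \<open>The last assumption is the abstract form of sphericity: almost every point sees the same
proportion \<open>q\<close> of the space as related to itself. It makes the events that two points are related
pairwise independent, although the three events of a triangle need not be jointly independent.\<close>

locale indep_pair_relation = prob_space M
  for M :: "'a measure" +
  fixes N :: "'b measure" and X :: "nat \<Rightarrow> 'a \<Rightarrow> 'b" and p :: nat
    and R :: "'b \<Rightarrow> 'b \<Rightarrow> bool" and q :: real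
  assumes indep: "indep_vars (\<lambda>_. N) X {1..p}"
    and R_measurable: "{z \<in> space (N \<Otimes>\<^sub>M N). R (fst z) (snd z)} \<in> sets (N \<Otimes>\<^sub>M N)"
    and R_sym: "R x y \<longleftrightarrow> R y x"
    and R_prob: "\<And>i j. i \<in> {1..p} \<Longrightarrow> j \<in> {1..p} \<Longrightarrow> i \<noteq> j \<Longrightarrow>
      AE \<omega> in M. prob {\<omega>' \<in> space M. R (X i \<omega>) (X j \<omega>')} = q"
begin

definition unrelated :: "nat \<Rightarrow> 'a set" where
  "unrelated m = {\<omega> \<in> space M. \<forall>i j. 1 \<le> i \<and> i < j \<and> j \<le> m \<longrightarrow> \<not> R (X i \<omega>) (X j \<omega>)}"

definition related :: "nat \<Rightarrow> nat \<Rightarrow> 'a set" where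
  "related i j = {\<omega> \<in> space M. R (X i \<omega>) (X j \<omega>)}"

lemma X_measurable: "i \<in> {1..p} \<Longrightarrow> X i \<in> measurable M N"
  using indep by (auto simp: indep_vars_def)

lemma R_pred:
  assumes "f \<in> measurable L N" "g \<in> measurable L N"
  shows "{\<omega> \<in> space L. R (f \<omega>) (g \<omega>)} \<in> sets L"
proof -
  have "(\<lambda>\<omega>. (f \<omega>, g \<omega>)) \<in> measurable L (N \<Otimes>\<^sub>M N)" using assms by simp
  then have "(\<lambda>\<omega>. (f \<omega>, g \<omega>)) -` {z \<in> space (N \<Otimes>\<^sub>M N). R (fst z) (snd z)} \<inter> space L \<in> sets L"
    using R_measurable by (rule measurable_sets)
  also have "(\<lambda>\<omega>. (f \<omega>, g \<omega>)) -` {z \<in> space (N \<Otimes>\<^sub>M N). R (fst z) (snd z)} \<inter> space L =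
      {\<omega> \<in> space L. R (f \<omega>) (g \<omega>)}"
    using measurable_space[OF assms(1)] measurable_space[OF assms(2)]
    by (auto simp: space_pair_measure)
  finally show ?thesis .
qed

lemma related_sets: "i \<in> {1..p} \<Longrightarrow> j \<in> {1..p} \<Longrightarrow> related i j \<in> events"
  unfolding related_def by (intro R_pred X_measurable)

lemma unrelated_sets: "m \<le> p \<Longrightarrow> unrelated m \<in> events"
proof -
  assume "m \<le> p"
  have "unrelated m = space M - (\<Union>j\<in>{1..m}. \<Union>i\<in>{1..<j}. related i j)"
    unfolding unrelated_def related_def by fastforce
  also have "\<dots> \<in> events"
    using \<open>m \<le> p\<close> by (intro sets.Diff sets.top sets.finite_UN related_sets) auto
  finally show ?thesis .
qed

text \<open>Whether a point outside \<open>J\<close> is related to the point \<open>k\<close> is independent of everything that concerns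
the points in \<open>J\<close>, although \<open>k\<close> itself belongs to \<open>J\<close>. All probabilities needed for the Poisson
approximation are instances.\<close>

lemma prob_fresh_related:
  assumes J: "J \<subseteq> {1..p}" and k: "k \<in> J" and j: "j \<in> {1..p} - J"
    and B: "{x \<in> space (PiM J (\<lambda>_. N)). Q x} \<in> sets (PiM J (\<lambda>_. N))"
  shows "prob {\<omega> \<in> space M. Q (\<lambda>i\<in>J. X i \<omega>) \<and> R (X k \<omega>) (X j \<omega>)} =
    q * prob {\<omega> \<in> space M. Q (\<lambda>i\<in>J. X i \<omega>)}"
proof -
  define U where "U = (\<lambda>\<omega>. \<lambda>i\<in>J. X i \<omega>)"
  define V where "V = (\<lambda>\<omega>. \<lambda>i\<in>{j}. X i \<omega>)"
  let ?S = "PiM J (\<lambda>_. N)" and ?T = "PiM {j} (\<lambda>_. N)"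
  define E where "E = {z \<in> space (?S \<Otimes>\<^sub>M ?T). R (fst z k) (snd z j)}"
  define B where "B = {x \<in> space ?S. Q x}"
  have UV: "indep_var ?S U ?T V"
    unfolding U_def V_def using J j by (intro indep_var_restrict[OF indep]) auto
  then have U: "U \<in> measurable M ?S" and V: "V \<in> measurable M ?T"
    by (auto simp: indep_var_distribution_eq)
  have E: "E \<in> sets (?S \<Otimes>\<^sub>M ?T)" unfolding E_def
    using k by (intro R_pred measurable_compose[OF measurable_fst] measurable_compose[OF measurable_snd]
      measurable_component_singleton) auto
  have mem: "(U \<omega>, V \<omega>') \<in> E \<longleftrightarrow> R (X k \<omega>) (X j \<omega>')" if "\<omega> \<in> space M" "\<omega>' \<in> space M" for \<omega> \<omega>'
    using measurable_space[OF U that(1)] measurable_space[OF V that(2)] k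
    by (auto simp: E_def space_pair_measure U_def V_def)
  have B_mem: "U \<omega> \<in> B \<longleftrightarrow> Q (\<lambda>i\<in>J. X i \<omega>)" if "\<omega> \<in> space M" for \<omega>
    using measurable_space[OF U that] by (simp add: B_def U_def)
  have "AE \<omega> in M. prob {\<omega>' \<in> space M. R (X k \<omega>) (X j \<omega>')} = q"
    using J k j by (intro R_prob) auto
  then have "AE \<omega> in M. prob {\<omega>' \<in> space M. (U \<omega>, V \<omega>') \<in> E} = q"
    using AE_space by eventually_elim (simp add: mem cong: conj_cong)
  from prob_indep_section[OF UV E _ this, of B] assms(4) show ?thesis
    by (simp add: B_def[symmetric] mem B_mem cong: conj_cong)
qed

lemma prob_related:
  assumes "i \<in> {1..p}" "j \<in> {1..p}" "i \<noteq> j"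
  shows "prob (related i j) = q"
  using prob_fresh_related[of "{i}" i j "\<lambda>_. True"] assms
  by (simp add: related_def prob_space)

lemma prob_related_both:
  assumes "i \<in> {1..p}" "j \<in> {1..p}" "m \<in> {1..p}" "i \<noteq> m" "j \<noteq> m" "i \<noteq> j"
  shows "prob (related i m \<inter> related j m) = q\<^sup>2"
proof -
  (* the pair i, m is revealed; j is fresh and is compared with m only *)
  let ?Q = "\<lambda>x. R (x i) (x m)"
  have "prob {\<omega> \<in> space M. ?Q (\<lambda>l\<in>{i, m}. X l \<omega>) \<and> R (X m \<omega>) (X j \<omega>)}
      = q * prob {\<omega> \<in> space M. ?Q (\<lambda>l\<in>{i, m}. X l \<omega>)}"
    using assms by (intro prob_fresh_related R_pred measurable_component_singleton) auto
  moreover have "{\<omega> \<in> space M. ?Q (\<lambda>l\<in>{i, m}. X l \<omega>) \<and> R (X m \<omega>) (X j \<omega>)} = related i m \<inter> related j m"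
  proof -
    have "R (X m \<omega>) (X j \<omega>) \<longleftrightarrow> R (X j \<omega>) (X m \<omega>)" for \<omega> by (rule R_sym)
    then show ?thesis by (auto simp: related_def)
  qed
  moreover have "{\<omega> \<in> space M. ?Q (\<lambda>l\<in>{i, m}. X l \<omega>)} = related i m"
    by (auto simp: related_def)
  ultimately show ?thesis
    using prob_related[OF assms(1,3,4)] by (simp only: power2_eq_square)
qed

lemma prob_unrelated_Int_related:
  assumes "i \<in> {1..m}" "Suc m \<le> p"
  shows "prob (unrelated m \<inter> related i (Suc m)) = q * prob (unrelated m)"
proof -
  let ?Q = "\<lambda>x. \<forall>i\<in>{1..m}. \<forall>j\<in>{1..m}. i < j \<longrightarrow> \<not> R (x i) (x j)"
  have meas: "{x \<in> space (PiM {1..m} (\<lambda>_. N)). ?Q x} \<in> sets (PiM {1..m} (\<lambda>_. N))"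
    by (intro sets.sets_Collect_finite_All sets.sets_Collect_imp sets.sets_Collect_neg R_pred
        measurable_component_singleton sets.sets_Collect_const) auto
  have "prob {\<omega> \<in> space M. ?Q (\<lambda>l\<in>{1..m}. X l \<omega>) \<and> R (X i \<omega>) (X (Suc m) \<omega>)} =
     q * prob {\<omega> \<in> space M. ?Q (\<lambda>l\<in>{1..m}. X l \<omega>)}"
  proof (rule prob_fresh_related[where Q="?Q", OF _ _ _ meas])
    show "{1..m} \<subseteq> {1..p}" "i \<in> {1..m}" "Suc m \<in> {1..p} - {1..m}" using assms by auto
  qed
  moreover have "{\<omega> \<in> space M. ?Q (\<lambda>l\<in>{1..m}. X l \<omega>)} = unrelated m"
    by (auto simp: unrelated_def)
  moreover have "{\<omega> \<in> space M. ?Q (\<lambda>l\<in>{1..m}. X l \<omega>) \<and> R (X i \<omega>) (X (Suc m) \<omega>)}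
      = unrelated m \<inter> related i (Suc m)"
    by (auto simp: unrelated_def related_def)
  ultimately show ?thesis by simp
qed

end

text \<open>The correction terms are bounded by the intersections of the \<open>A i\<close> alone, with \<open>C\<close> dropped, so that
only pairwise information about the \<open>A i\<close> enters.\<close>

lemma (in prob_space) Bonferroni_UN:
  assumes "\<And>i. i \<in> {1..m} \<Longrightarrow> A i \<in> events" and "C \<in> events"
    and pair: "\<And>i j. i \<in> {1..m} \<Longrightarrow> j \<in> {1..m} \<Longrightarrow> i \<noteq> j \<Longrightarrow> prob (A i \<inter> A j) \<le> c"
  shows "\<bar>prob (C \<inter> (\<Union>i\<in>{1..m}. A i)) - (\<Sum>i\<in>{1..m}. prob (C \<inter> A i))\<bar> \<le> real m * (real m - 1) / 2 * c"
  using assms(1) pair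
proof (induction m)
  case (Suc m)
  let ?U = "\<Union>i\<in>{1..m}. A i"
  have sets: "A (Suc m) \<in> events" "?U \<in> events" using Suc.prems(1) by (auto intro!: sets.finite_UN)
  have eq: "{1..Suc m} = insert (Suc m) {1..m}" by auto
  have "prob (C \<inter> (\<Union>i\<in>{1..Suc m}. A i)) = prob ((C \<inter> ?U) \<union> (C \<inter> A (Suc m)))"
    unfolding eq by (rule arg_cong[where f=prob]) auto
  also have "\<dots> = prob (C \<inter> ?U) + prob (C \<inter> A (Suc m)) - prob ((C \<inter> ?U) \<inter> (C \<inter> A (Suc m)))"
    using sets assms(2) measure_Un3[of "C \<inter> ?U" M "C \<inter> A (Suc m)"] by (simp add: fmeasurable_eq_sets)
  finally have 1: "prob (C \<inter> (\<Union>i\<in>{1..Suc m}. A i)) =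
     prob (C \<inter> ?U) + prob (C \<inter> A (Suc m)) - prob ((C \<inter> ?U) \<inter> (C \<inter> A (Suc m)))" .
  have "prob ((C \<inter> ?U) \<inter> (C \<inter> A (Suc m))) \<le> prob (\<Union>i\<in>{1..m}. A i \<inter> A (Suc m))"
    using Suc.prems(1) by (intro finite_measure_mono sets.finite_UN sets.Int) auto
  also have "\<dots> \<le> (\<Sum>i\<in>{1..m}. prob (A i \<inter> A (Suc m)))"
    using Suc.prems(1) by (intro finite_measure_subadditive_finite) auto
  also have "\<dots> \<le> (\<Sum>i\<in>{1..m}. c)"
    by (intro sum_mono Suc.prems(2)) auto
  finally have 2: "prob ((C \<inter> ?U) \<inter> (C \<inter> A (Suc m))) \<le> real m * c" by simp
  have "\<bar>prob (C \<inter> ?U) - (\<Sum>i\<in>{1..m}. prob (C \<inter> A i))\<bar> \<le> real m * (real m - 1) / 2 * c"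
    by (intro Suc.IH Suc.prems) auto
  moreover have "real (Suc m) * (real (Suc m) - 1) / 2 * c = real m * (real m - 1) / 2 * c + real m * c"
    by (simp add: field_simps)
  moreover have "(\<Sum>i\<in>{1..Suc m}. prob (C \<inter> A i)) = prob (C \<inter> A (Suc m)) + (\<Sum>i\<in>{1..m}. prob (C \<inter> A i))"
    unfolding eq by (subst sum.insert) auto
  ultimately show ?case
    unfolding 1 using 2 measure_nonneg[of M "(C \<inter> ?U) \<inter> (C \<inter> A (Suc m))"] by linarith
qed simp

lemma abs_exp_minus_remainder:
  fixes x :: real assumes "0 \<le> x"
  shows "\<bar>1 - x - exp (- x)\<bar> \<le> x\<^sup>2 / 2"
proof -
  have "1 - x \<le> exp (- x)" using exp_ge_add_one_self[of "- x"] by simp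
  moreover have "exp (- x) \<le> 1 - x + x\<^sup>2 / 2"
  proof -
    have "(1 - 0 + 0\<^sup>2 / 2) - exp (- 0) \<le> (1 - x + x\<^sup>2 / 2) - exp (- x)"
    proof (rule DERIV_nonneg_imp_nondecreasing[OF assms])
      fix y :: real assume "0 \<le> y" "y \<le> x"
      have "((\<lambda>y. (1 - y + y\<^sup>2 / 2) - exp (- y)) has_real_derivative (- 1 + y + exp (- y))) (at y)"
        by (auto intro!: derivative_eq_intros)
      moreover have "0 \<le> - 1 + y + exp (- y)" using exp_ge_add_one_self[of "- y"] by simp
      ultimately show "\<exists>z. ((\<lambda>y. (1 - y + y\<^sup>2 / 2) - exp (- y)) has_real_derivative z) (at y) \<and> 0 \<le> z"
        by blast
    qed
    then show ?thesis by simp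
  qed
  ultimately show ?thesis by linarith
qed

context indep_pair_relation
begin

text \<open>One half of the error comes from Bonferroni, the other from replacing \<open>1 - m q\<close> by \<open>exp (- m q)\<close>.
The exponential has the advantage of staying in \<open>[0, 1]\<close> whatever the size of \<open>m q\<close>, so errors are
not amplified when the steps are composed.\<close>

lemma unrelated_step:
  assumes "Suc m \<le> p" "0 \<le> q"
  shows "\<bar>prob (unrelated (Suc m)) - exp (- (real m * q)) * prob (unrelated m)\<bar> \<le> (real m)\<^sup>2 * q\<^sup>2"
proof -
  let ?U = "\<Union>i\<in>{1..m}. related i (Suc m)"
  have sets: "unrelated m \<in> events" "\<And>i. i \<in> {1..m} \<Longrightarrow> related i (Suc m) \<in> events" "?U \<in> events"
    using assms by (auto intro!: unrelated_sets related_sets sets.finite_UN)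
  have "unrelated (Suc m) = unrelated m - unrelated m \<inter> ?U"
    unfolding unrelated_def related_def by (auto simp: le_Suc_eq)
  then have 1: "prob (unrelated (Suc m)) = prob (unrelated m) - prob (unrelated m \<inter> ?U)"
    using sets by (simp add: finite_measure_Diff)
  have "\<bar>prob (unrelated m \<inter> ?U) - (\<Sum>i\<in>{1..m}. prob (unrelated m \<inter> related i (Suc m)))\<bar>
      \<le> real m * (real m - 1) / 2 * q\<^sup>2"
    using sets assms by (intro Bonferroni_UN) (auto simp: prob_related_both)
  also have "(\<Sum>i\<in>{1..m}. prob (unrelated m \<inter> related i (Suc m))) = real m * q * prob (unrelated m)"
    using assms by (simp add: prob_unrelated_Int_related)
  also have "real m * (real m - 1) / 2 * q\<^sup>2 \<le> (real m)\<^sup>2 / 2 * q\<^sup>2"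
    by (intro mult_right_mono divide_right_mono) (auto simp: power2_eq_square algebra_simps)
  finally have 2: "\<bar>prob (unrelated (Suc m)) - (1 - real m * q) * prob (unrelated m)\<bar>
      \<le> (real m)\<^sup>2 / 2 * q\<^sup>2"
    unfolding 1 by (simp add: algebra_simps abs_minus_commute)
  have "\<bar>(1 - real m * q) * prob (unrelated m) - exp (- (real m * q)) * prob (unrelated m)\<bar>
     = \<bar>1 - real m * q - exp (- (real m * q))\<bar> * prob (unrelated m)"
    by (simp add: left_diff_distrib[symmetric] abs_mult)
  also have "\<dots> \<le> (real m * q)\<^sup>2 / 2 * 1"
    using assms by (intro mult_mono abs_exp_minus_remainder) auto
  finally have "\<bar>(1 - real m * q) * prob (unrelated m) - exp (- (real m * q)) * prob (unrelated m)\<bar>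
      \<le> (real m)\<^sup>2 / 2 * q\<^sup>2" by (simp add: power_mult_distrib)
  moreover have "(real m)\<^sup>2 / 2 * q\<^sup>2 + (real m)\<^sup>2 / 2 * q\<^sup>2 = (real m)\<^sup>2 * q\<^sup>2" by simp
  ultimately show ?thesis using 2 by linarith
qed

lemma prob_unrelated_approx:
  assumes "m \<le> p" "0 \<le> q"
  shows "\<bar>prob (unrelated m) - exp (- (real m * (real m - 1) / 2 * q))\<bar> \<le> real m ^ 3 * q\<^sup>2"
  using assms(1)
proof (induction m)
  case 0
  have "unrelated 0 = space M" by (auto simp: unrelated_def)
  then show ?case by (simp add: prob_space)
next
  case (Suc m)
  let ?e = "exp (- (real m * (real m - 1) / 2 * q))"
  have e: "exp (- (real (Suc m) * (real (Suc m) - 1) / 2 * q)) = exp (- (real m * q)) * ?e"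
    unfolding exp_add[symmetric] by (rule arg_cong[where f=exp]) (simp add: field_simps)
  have "\<bar>exp (- (real m * q)) * prob (unrelated m) - exp (- (real m * q)) * ?e\<bar>
      = exp (- (real m * q)) * \<bar>prob (unrelated m) - ?e\<bar>"
    by (simp add: right_diff_distrib[symmetric] abs_mult)
  also have "\<dots> \<le> 1 * (real m ^ 3 * q\<^sup>2)"
    using Suc assms(2) by (intro mult_mono Suc.IH) auto
  finally have "\<bar>prob (unrelated (Suc m)) - exp (- (real m * q)) * ?e\<bar> \<le> (real m)\<^sup>2 * q\<^sup>2 + real m ^ 3 * q\<^sup>2"
    using unrelated_step[OF Suc.prems assms(2)] by linarith
  also have "\<dots> = ((real m)\<^sup>2 + real m ^ 3) * q\<^sup>2" by (simp add: algebra_simps)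
  also have "\<dots> \<le> real (Suc m) ^ 3 * q\<^sup>2"
    by (intro mult_right_mono) (auto simp: power3_eq_cube power2_eq_square algebra_simps)
  finally show ?case unfolding e .
qed

end

section \<open>Asymptotics of the tail probability\<close>

text \<open>On \<open>[1 - s, 1]\<close> the factor \<open>x\<^bsup>-1/2\<^esup>\<close> of the density lies between \<open>1\<close> and \<open>(1 - s)\<^bsup>-1/2\<^esup>\<close>, and
the remaining factor integrates exactly. The relative error does not involve \<open>b\<close>, which matters
because \<open>b\<close> grows with the dimension while \<open>s\<close> may tend to \<open>0\<close> arbitrarily slowly.\<close>

lemma beta_half_tail:
  assumes b: "0 < b" and s: "0 \<le> s" "s < 1"
  shows "s powr b / (b * Beta (1 / 2) b) \<le> measure (beta_distr (1 / 2) b) {1 - s..}"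
    and "measure (beta_distr (1 / 2) b) {1 - s..} \<le> s powr b / (b * Beta (1 / 2) b) / sqrt (1 - s)"
proof -
  interpret real_distribution "beta_distr (1 / 2) b" using b by (intro real_distribution_beta) auto
  have B: "0 < Beta (1 / 2) b" using b by (intro Beta_pos) auto
  define g where "g = (\<lambda>x. (1 - x) powr (b - 1) / Beta (1 / 2) b)"
  have I: "(g has_integral (s powr b / (b * Beta (1 / 2) b))) {1 - s..1}"
  proof -
    define G where "G = (\<lambda>x. - ((1 - x) powr b / (b * Beta (1 / 2) b)))"
    have "(g has_integral (G 1 - G (1 - s))) {1 - s..1}"
    proof (rule fundamental_theorem_of_calculus_interior)
      have "continuous_on {1 - s..1} (\<lambda>x. (1 - x) powr b)"
        using b by (intro continuous_on_powr') (auto intro!: continuous_intros)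
      then show "continuous_on {1 - s..1} G"
        unfolding G_def using b B by (intro continuous_on_minus continuous_on_divide) auto
      fix x assume "x \<in> {1 - s<..<1}"
      then show "(G has_vector_derivative g x) (at x)"
        unfolding G_def g_def has_real_derivative_iff_has_vector_derivative[symmetric] using b B
        by (auto intro!: derivative_eq_intros simp: field_simps)
    qed (use s in auto)
    then show ?thesis using b by (simp add: G_def)
  qed
  have g0: "0 \<le> g x" for x using B by (simp add: g_def)
  let ?v = "s powr b / (b * Beta (1 / 2) b)"
  have v0: "0 \<le> ?v" using b B by simp
  have nn: "(\<integral>\<^sup>+x. ennreal (indicator {1 - s..1} x * g x) \<partial>lborel) = ennreal ?v"
    using nn_integral_has_integral_lebesgue[OF g0 I] by simp
  have em: "emeasure (beta_distr (1 / 2) b) {1 - s..} =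
      (\<integral>\<^sup>+x. ennreal (beta_density (1 / 2) b x) * indicator {1 - s..} x \<partial>lborel)"
    unfolding beta_distr_def by (subst emeasure_density) auto
  have pw: "x powr (1 / 2 - 1) = 1 / sqrt x" if "0 < x" for x :: real
  proof -
    have "x powr (1 / 2 - 1) = x powr (- (1 / 2))" by simp
    also have "\<dots> = 1 / x powr (1 / 2)" by (rule powr_minus_divide)
    also have "x powr (1 / 2) = sqrt x" using that by (intro powr_half_sqrt) simp
    finally show ?thesis .
  qed
  have lo: "indicator {1 - s..1} x * g x \<le> beta_density (1 / 2) b x * indicator {1 - s..} x" for x
  proof (cases "x \<in> {1 - s..1}")
    case True
    with s have x: "0 < x" "x \<le> 1" by auto
    then have "1 \<le> x powr (1 / 2 - 1)" unfolding pw[OF x(1)] by simp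
    then have "1 * g x \<le> x powr (1 / 2 - 1) * g x" using g0 by (intro mult_right_mono) auto
    with True x show ?thesis by (simp add: beta_density_def g_def)
  next
    case False
    then have "indicator {1 - s..1} x * g x = 0" by simp
    also have "0 \<le> beta_density (1 / 2) b x * indicator {1 - s..} x"
      using b by (intro mult_nonneg_nonneg beta_density_nonneg) auto
    finally show ?thesis .
  qed
  have hi: "beta_density (1 / 2) b x * indicator {1 - s..} x \<le> 1 / sqrt (1 - s) * (indicator {1 - s..1} x * g x)" for x
  proof (cases "x \<in> {1 - s..1}")
    case True
    with s have x: "0 < x" "x \<le> 1" by auto
    have "x powr (1 / 2 - 1) \<le> 1 / sqrt (1 - s)"
      unfolding pw[OF x(1)] using True s by (intro divide_left_mono) auto
    then have "x powr (1 / 2 - 1) * g x \<le> 1 / sqrt (1 - s) * g x" using g0 by (intro mult_right_mono) auto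
    with True x show ?thesis by (simp add: beta_density_def g_def)
  qed (auto simp: beta_density_def split: split_indicator)
  have "ennreal ?v \<le> emeasure (beta_distr (1 / 2) b) {1 - s..}"
    unfolding em nn[symmetric]
    by (intro nn_integral_mono)
      (simp add: ennreal_mult''[symmetric] ennreal_indicator[symmetric], intro ennreal_leI lo)
  then show "?v \<le> measure (beta_distr (1 / 2) b) {1 - s..}"
    using v0 by (simp add: emeasure_eq_measure)
  have "emeasure (beta_distr (1 / 2) b) {1 - s..} \<le>
      (\<integral>\<^sup>+x. ennreal (1 / sqrt (1 - s)) * ennreal (indicator {1 - s..1} x * g x) \<partial>lborel)"
    unfolding em
    by (intro nn_integral_mono)
      (use hi s g0 in \<open>simp add: ennreal_mult''[symmetric] ennreal_mult[symmetric] ennreal_indicator[symmetric]\<close>)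
  also have "\<dots> = ennreal (1 / sqrt (1 - s)) * ennreal ?v"
    using nn by (subst nn_integral_cmult) (auto simp: g_def)
  also have "\<dots> = ennreal (?v / sqrt (1 - s))"
    using v0 s by (simp add: ennreal_mult[symmetric] mult.commute)
  finally have "emeasure (beta_distr (1 / 2) b) {1 - s..} \<le> ennreal (?v / sqrt (1 - s))" .
  moreover have "0 \<le> ?v / sqrt (1 - s)"
    by (rule divide_nonneg_nonneg[OF v0]) (use s in simp)
  ultimately show "measure (beta_distr (1 / 2) b) {1 - s..} \<le> ?v / sqrt (1 - s)"
    by (simp only: emeasure_eq_measure ennreal_le_iff)
qed

text \<open>Log-convexity at the midpoint of \<open>x\<close> and \<open>x + 1\<close> gives
\<open>\<Gamma>(x + 1/2)\<^sup>2 \<le> \<Gamma>(x) \<Gamma>(x + 1) = x \<Gamma>(x)\<^sup>2\<close>.\<close>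

lemma Gamma_ratio_le_sqrt:
  fixes x :: real assumes x: "0 < x"
  shows "Gamma (x + 1 / 2) / Gamma x \<le> sqrt x"
proof -
  have pos: "0 < Gamma x" "0 < Gamma (x + 1 / 2)" using x by (auto intro: Gamma_real_pos)
  have Suc: "Gamma (x + 1) = x * Gamma x"
    using x by (intro Gamma_plus1) (auto elim!: nonpos_Ints_cases)
  have "(ln \<circ> Gamma) ((1 - 1 / 2) *\<^sub>R x + (1 / 2) *\<^sub>R (x + 1)) \<le>
      (1 - 1 / 2) * (ln \<circ> Gamma) x + 1 / 2 * (ln \<circ> Gamma) (x + 1)"
    by (rule convex_onD[OF log_convex_Gamma_real]) (use x in auto)
  moreover have "(1 - 1 / 2) *\<^sub>R x + (1 / 2) *\<^sub>R (x + 1) = x + 1 / 2" by (simp add: field_simps)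
  ultimately have "2 * ln (Gamma (x + 1 / 2)) \<le> ln (Gamma x) + ln (Gamma (x + 1))" by simp
  also have "\<dots> = ln (x * (Gamma x)\<^sup>2)"
    using x pos by (simp add: Suc ln_mult power2_eq_square)
  also have "2 * ln (Gamma (x + 1 / 2)) = ln ((Gamma (x + 1 / 2))\<^sup>2)"
    using pos by (simp add: ln_realpow)
  finally have "(Gamma (x + 1 / 2))\<^sup>2 \<le> x * (Gamma x)\<^sup>2"
    using x pos by (simp del: ln_powr)
  then have "Gamma (x + 1 / 2) \<le> sqrt (x * (Gamma x)\<^sup>2)" by (rule real_le_rsqrt)
  then show ?thesis using pos by (simp add: real_sqrt_mult divide_le_eq)
qed

text \<open>The ratios at \<open>x\<close> and \<open>x + 1/2\<close> multiply to \<open>x\<close>, so the upper bound at \<open>x + 1/2\<close> is a lower bound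
at \<open>x\<close>.\<close>

lemma Gamma_ratio_ge:
  fixes x :: real assumes x: "0 < x"
  shows "x / sqrt (x + 1 / 2) \<le> Gamma (x + 1 / 2) / Gamma x"
proof -
  have pos: "0 < Gamma x" "0 < Gamma (x + 1 / 2)" using x by (auto intro: Gamma_real_pos)
  have Suc: "Gamma (x + 1) = x * Gamma x"
    using x by (intro Gamma_plus1) (auto elim!: nonpos_Ints_cases)
  have "Gamma (x + 1 / 2 + 1 / 2) / Gamma (x + 1 / 2) \<le> sqrt (x + 1 / 2)"
    using x by (intro Gamma_ratio_le_sqrt) simp
  then have "x * Gamma x \<le> sqrt (x + 1 / 2) * Gamma (x + 1 / 2)"
    using pos by (simp add: Suc[symmetric] divide_le_eq add.commute)
  then show ?thesis using pos x by (simp add: field_simps)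
qed

lemma beta_half_constant_asymp:
  "(\<lambda>n. sqrt (real n) / ((real n - 1) / 2 * Beta (1 / 2) ((real n - 1) / 2))) \<longlonglongrightarrow> sqrt 2 / sqrt pi"
proof (rule tendsto_sandwich)
  define b where "b = (\<lambda>n::nat. (real n - 1) / 2)"
  have Beta: "Beta (1 / 2) c = sqrt pi * Gamma c / Gamma (c + 1 / 2)" for c :: real
    unfolding Beta_def Gamma_one_half_real rGamma_inverse_Gamma
    by (simp only: divide_inverse add.commute[of c])
  have eq: "sqrt (real n) / ((real n - 1) / 2 * Beta (1 / 2) ((real n - 1) / 2)) =
      sqrt (real n) / (b n * sqrt pi) * (Gamma (b n + 1 / 2) / Gamma (b n))" for n
  proof -
    have "(real n - 1) / 2 = b n" by (simp add: b_def)
    then show ?thesis by (simp only: Beta) simp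
  qed
  have pos: "\<forall>\<^sub>F n in sequentially. 0 < b n"
    using eventually_gt_at_top[of 1] by eventually_elim (simp add: b_def)
  show "\<forall>\<^sub>F n in sequentially. sqrt (real n / (b n + 1 / 2)) / sqrt pi \<le>
      sqrt (real n) / ((real n - 1) / 2 * Beta (1 / 2) ((real n - 1) / 2))"
    using pos unfolding eq
  proof eventually_elim
    case (elim n)
    have "sqrt (real n / (b n + 1 / 2)) / sqrt pi =
        sqrt (real n) / (b n * sqrt pi) * (b n / sqrt (b n + 1 / 2))"
      using elim by (simp add: real_sqrt_divide)
    also have "\<dots> \<le> sqrt (real n) / (b n * sqrt pi) * (Gamma (b n + 1 / 2) / Gamma (b n))"
      using elim by (intro mult_left_mono Gamma_ratio_ge) auto
    finally show ?case .
  qed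
  show "\<forall>\<^sub>F n in sequentially. sqrt (real n) / ((real n - 1) / 2 * Beta (1 / 2) ((real n - 1) / 2))
      \<le> sqrt (real n / b n) / sqrt pi"
    using pos unfolding eq
  proof eventually_elim
    case (elim n)
    have "sqrt (real n) / (b n * sqrt pi) * (Gamma (b n + 1 / 2) / Gamma (b n)) \<le>
        sqrt (real n) / (b n * sqrt pi) * sqrt (b n)"
      using elim by (intro mult_left_mono Gamma_ratio_le_sqrt) auto
    also have "\<dots> = sqrt (real n) / sqrt pi * (sqrt (b n) / b n)" by simp
    also have "sqrt (b n) / b n = inverse (sqrt (b n))"
      using elim by (intro sqrt_divide_self_eq) simp
    finally show ?case using elim by (simp add: real_sqrt_divide field_simps)
  qed
  have "(\<lambda>n. real n / (b n + 1 / 2)) \<longlonglongrightarrow> 2" "(\<lambda>n. real n / b n) \<longlonglongrightarrow> 2"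
    unfolding b_def by real_asymp+
  from this[THEN tendsto_real_sqrt, THEN tendsto_divide, OF tendsto_const[of "sqrt pi"]]
  show "(\<lambda>n. sqrt (real n / (b n + 1 / 2)) / sqrt pi) \<longlonglongrightarrow> sqrt 2 / sqrt pi"
    and "(\<lambda>n. sqrt (real n / b n) / sqrt pi) \<longlonglongrightarrow> sqrt 2 / sqrt pi"
    by simp_all
qed

text \<open>The probability that two independent spherical vectors in dimension \<open>n\<close> satisfy
\<open>\<rho>\<^sup>2 \<ge> 1 - s\<close>.\<close>

definition pair_tail :: "nat \<Rightarrow> real \<Rightarrow> real" where
  "pair_tail n s = measure (beta_distr (1 / 2) ((real n - 1) / 2)) {1 - s..}"

text \<open>The value of \<open>1 - L\<^sup>2\<close> at which the normalized statistic equals \<open>y\<close>.\<close>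

definition threshold :: "nat \<Rightarrow> nat \<Rightarrow> real \<Rightarrow> real" where
  "threshold n p y = exp ((y + ln (real n)) / real n - 4 / (real n - 1) * ln (real p))"

context
  fixes p :: "nat \<Rightarrow> nat"
  assumes p: "filterlim (\<lambda>n. ln (real (p n)) / real n) at_top sequentially"
begin

lemma ln_p_at_top: "filterlim (\<lambda>n. ln (real (p n))) at_top sequentially"
proof (rule filterlim_at_top_mono[OF p])
  show "\<forall>\<^sub>F n in sequentially. ln (real (p n)) / real n \<le> ln (real (p n))"
    using eventually_ge_at_top[of 1]
  proof eventually_elim
    case (elim n)
    have "0 \<le> ln (real (p n))" by (cases "p n = 0") auto
    then have "ln (real (p n)) * 1 \<le> ln (real (p n)) * real n"
      using elim by (intro mult_left_mono) auto
    with elim show ?case by (simp add: divide_le_eq)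
  qed
qed

lemma p_at_top: "filterlim (\<lambda>n. real (p n)) at_top sequentially"
proof (rule filterlim_at_top_mono[OF ln_p_at_top])
  have "ln (real (p n)) \<le> real (p n)" for n
    by (cases "p n = 0") (auto intro: ln_bound)
  then show "\<forall>\<^sub>F n in sequentially. ln (real (p n)) \<le> real (p n)" by simp
qed

lemma threshold_tendsto_0: "(\<lambda>n. threshold n (p n) y) \<longlonglongrightarrow> 0"
proof -
  have "filterlim (\<lambda>n. - 1 + ln (real (p n)) / real n) at_top sequentially"
    by (rule filterlim_tendsto_add_at_top[OF tendsto_const p])
  then have "filterlim (\<lambda>n. - ((y + ln (real n)) / real n - 4 / (real n - 1) * ln (real (p n)))) at_top sequentially"
  proof (rule filterlim_at_top_mono)
    have "(\<lambda>n. (y + ln (real n)) / real n) \<longlonglongrightarrow> 0" by real_asymp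
    then have "\<forall>\<^sub>F n in sequentially. (y + ln (real n)) / real n < 1"
      by (rule order_tendstoD) simp
    then show "\<forall>\<^sub>F n in sequentially. - 1 + ln (real (p n)) / real n \<le>
        - ((y + ln (real n)) / real n - 4 / (real n - 1) * ln (real (p n)))"
      using eventually_ge_at_top[of 2]
    proof eventually_elim
      case (elim n)
      have "0 \<le> ln (real (p n))" by (cases "p n = 0") auto
      then have "1 / real n * ln (real (p n)) \<le> 4 / (real n - 1) * ln (real (p n))"
        using elim by (intro mult_right_mono) (auto simp: field_simps)
      then show ?case using elim(1) by (simp only: minus_diff_eq) simp
    qed
  qed
  then have "filterlim (\<lambda>n. (y + ln (real n)) / real n - 4 / (real n - 1) * ln (real (p n))) at_bot sequentially"
    by (simp only: filterlim_uminus_at_bot)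
  then show ?thesis
    unfolding threshold_def by (rule filterlim_compose[OF exp_at_bot])
qed

text \<open>The expected number of pairs beyond the threshold. The power \<open>s\<^bsup>(n-1)/2\<^esup>\<close> contributes the factor
\<open>p\<^bsup>-2\<^esup>\<close>, which cancels the number of pairs, and asymptotically \<open>\<surd>n e\<^bsup>y/2\<^esup>\<close>, whose
\<open>\<surd>n\<close> is cancelled by the constant of the Beta tail.\<close>

lemma expected_pairs_tendsto:
  "(\<lambda>n. real (p n) * (real (p n) - 1) / 2 * pair_tail n (threshold n (p n) y)) \<longlonglongrightarrow> 1 / sqrt (2 * pi) * exp (y / 2)"
proof -
  define s where "s = (\<lambda>n. threshold n (p n) y)"
  define b where "b = (\<lambda>n::nat. (real n - 1) / 2)"
  define lam where "lam = (\<lambda>n. real (p n) * (real (p n) - 1) / 2 * (s n powr b n / (b n * Beta (1 / 2) (b n))))"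
  have s_pos: "0 < s n" for n by (simp add: s_def threshold_def)
  have s0: "s \<longlonglongrightarrow> 0" using threshold_tendsto_0 by (simp add: s_def)
  have s1: "\<forall>\<^sub>F n in sequentially. s n < 1" using s0 by (rule order_tendstoD) simp
  have p1: "\<forall>\<^sub>F n in sequentially. 1 < real (p n)"
    using p_at_top unfolding filterlim_at_top_dense by blast
  have lam: "lam \<longlonglongrightarrow> 1 / sqrt (2 * pi) * exp (y / 2)"
  proof -
    have "(\<lambda>n. 1 / real (p n)) \<longlonglongrightarrow> 0"
      by (rule tendsto_divide_0[OF tendsto_const filterlim_at_top_imp_at_infinity[OF p_at_top]])
    then have lim1: "(\<lambda>n. (1 - 1 / real (p n)) / 2) \<longlonglongrightarrow> (1 - 0) / 2"
      by (intro tendsto_intros) auto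
    have lim2: "(\<lambda>n. sqrt (real n) / (b n * Beta (1 / 2) (b n))) \<longlonglongrightarrow> sqrt 2 / sqrt pi"
      unfolding b_def by (rule beta_half_constant_asymp)
    have lim3: "(\<lambda>n. exp ((real n - 1) / (2 * real n) * (y + ln (real n))) / sqrt (real n)) \<longlonglongrightarrow> exp (y / 2)"
      by real_asymp
    note tendsto_mult[OF tendsto_mult[OF lim1 lim2] lim3]
    also have "(1 - 0) / 2 * (sqrt 2 / sqrt pi) * exp (y / 2) = 1 / sqrt (2 * pi) * exp (y / 2)"
      by (simp add: real_sqrt_mult field_simps)
    finally show ?thesis
    proof (rule Lim_transform_eventually)
      show "\<forall>\<^sub>F n in sequentially. (1 - 1 / real (p n)) / 2 * (sqrt (real n) / (b n * Beta (1 / 2) (b n))) *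
        (exp ((real n - 1) / (2 * real n) * (y + ln (real n))) / sqrt (real n)) = lam n"
        using p1 eventually_ge_at_top[of 2]
      proof eventually_elim
        case (elim n)
        have "b n * ((y + ln (real n)) / real n - 4 / (real n - 1) * ln (real (p n))) =
            (real n - 1) / (2 * real n) * (y + ln (real n)) - 2 * ln (real (p n))"
          using elim by (simp add: b_def field_simps)
        then have "s n powr b n = exp ((real n - 1) / (2 * real n) * (y + ln (real n)) - 2 * ln (real (p n)))"
          by (simp add: powr_def s_def threshold_def)
        also have "\<dots> = exp ((real n - 1) / (2 * real n) * (y + ln (real n))) / (real (p n))\<^sup>2"
          using elim by (simp add: exp_diff exp_double)
        finally have s_powr: "s n powr b n = exp ((real n - 1) / (2 * real n) * (y + ln (real n))) / (real (p n))\<^sup>2" .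
        have cancel: "(1 - 1 / P) / 2 * (r / B) * (E / r) = P * (P - 1) / 2 * (E / P\<^sup>2 / B)"
          if "P > 0" "r > 0" for P r B E :: real
          using that by (cases "B = 0") (auto simp: field_simps power2_eq_square)
        show ?case using elim unfolding lam_def s_powr by (intro cancel) auto
      qed
    qed
  qed
  have upper: "(\<lambda>n. lam n / sqrt (1 - s n)) \<longlonglongrightarrow> 1 / sqrt (2 * pi) * exp (y / 2) / sqrt (1 - 0)"
    by (intro tendsto_intros lam s0) simp
  show ?thesis
  proof (rule tendsto_sandwich[OF _ _ lam])
    have bounds: "\<forall>\<^sub>F n in sequentially.
      lam n \<le> real (p n) * (real (p n) - 1) / 2 * pair_tail n (s n) \<and>
      real (p n) * (real (p n) - 1) / 2 * pair_tail n (s n) \<le> lam n / sqrt (1 - s n)"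
      using s1 p1 eventually_ge_at_top[of 2]
    proof eventually_elim
      case (elim n)
      have b: "0 < b n" using elim by (simp add: b_def)
      have P: "0 \<le> real (p n) * (real (p n) - 1) / 2" using elim by simp
      have sn: "0 \<le> s n" "s n < 1" using s_pos[of n] elim by auto
      show ?case
        using mult_left_mono[OF beta_half_tail(1)[OF b sn] P] mult_left_mono[OF beta_half_tail(2)[OF b sn] P]
        unfolding lam_def pair_tail_def by (simp add: b_def)
    qed
    then show "\<forall>\<^sub>F n in sequentially. lam n \<le> real (p n) * (real (p n) - 1) / 2 * pair_tail n (threshold n (p n) y)"
      "\<forall>\<^sub>F n in sequentially. real (p n) * (real (p n) - 1) / 2 * pair_tail n (threshold n (p n) y) \<le> lam n / sqrt (1 - s n)"
      by (auto simp: s_def elim: eventually_mono)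
    show "(\<lambda>n. lam n / sqrt (1 - s n)) \<longlonglongrightarrow> 1 / sqrt (2 * pi) * exp (y / 2)"
      using upper by simp
  qed
qed

lemma approximation_error_tendsto_0:
  "(\<lambda>n. real (p n) ^ 3 * (pair_tail n (threshold n (p n) y))\<^sup>2) \<longlonglongrightarrow> 0"
proof -
  let ?l = "\<lambda>n. real (p n) * (real (p n) - 1) / 2 * pair_tail n (threshold n (p n) y)"
  (* the quotient of p^3 q^2 and the squared expected number of pairs *)
  define r where "r = (\<lambda>x::real. 4 * x / (x - 1)\<^sup>2)"
  have "(r \<longlongrightarrow> 0) at_top" unfolding r_def by real_asymp
  then have "(\<lambda>n. r (real (p n))) \<longlonglongrightarrow> 0" by (rule filterlim_compose[OF _ p_at_top])
  from tendsto_mult[OF this tendsto_power[OF expected_pairs_tendsto[of y], of 2]]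
  have "(\<lambda>n. r (real (p n)) * (?l n)\<^sup>2) \<longlonglongrightarrow> 0" by simp
  then show ?thesis
  proof (rule Lim_transform_eventually)
    have "\<forall>\<^sub>F n in sequentially. 1 < real (p n)"
      using p_at_top unfolding filterlim_at_top_dense by blast
    then show "\<forall>\<^sub>F n in sequentially. r (real (p n)) * (?l n)\<^sup>2 =
        real (p n) ^ 3 * (pair_tail n (threshold n (p n) y))\<^sup>2"
    proof eventually_elim
      case (elim n)
      have "4 * P / (P - 1)\<^sup>2 * (P * (P - 1) / 2 * t)\<^sup>2 = P ^ 3 * t\<^sup>2" if "1 < P" for P t :: real
        using that by (simp add: power_mult_distrib power_divide power3_eq_cube power2_eq_square)
      then show ?case using elim by (simp add: r_def)
    qed
  qed
qed

end

section \<open>The maximum over all pairs\<close>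

lemma pairs_finite: "finite {(i, j). 1 \<le> i \<and> i < j \<and> j \<le> (p::nat)}"
  by (rule finite_subset[of _ "{1..p} \<times> {1..p}"]) auto

lemma Lstat_eq_Max_image:
  "Lstat n p X \<omega> = Max ((\<lambda>z. \<bar>rho n (X (fst z) \<omega>) (X (snd z) \<omega>)\<bar>) ` {(i, j). 1 \<le> i \<and> i < j \<and> j \<le> p})"
  unfolding Lstat_def by (rule arg_cong[where f=Max]) force

lemma Lstat_less_iff:
  assumes "2 \<le> p"
  shows "Lstat n p X \<omega> < c \<longleftrightarrow> (\<forall>i j. 1 \<le> i \<and> i < j \<and> j \<le> p \<longrightarrow> \<bar>rho n (X i \<omega>) (X j \<omega>)\<bar> < c)"
proof -
  have "(1, 2) \<in> {(i, j). 1 \<le> i \<and> i < j \<and> j \<le> p}" using assms by auto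
  then have "{(i, j). 1 \<le> i \<and> i < j \<and> j \<le> p} \<noteq> {}" by blast
  then show ?thesis
    unfolding Lstat_eq_Max_image by (subst Max_less_iff[OF finite_imageI[OF pairs_finite]]) auto
qed

lemma Lstat_bounds:
  assumes "2 \<le> p"
  shows "0 \<le> Lstat n p X \<omega>" "Lstat n p X \<omega> \<le> 1"
proof -
  show "0 \<le> Lstat n p X \<omega>"
  proof (rule ccontr)
    assume "\<not> 0 \<le> Lstat n p X \<omega>"
    then have "\<bar>rho n (X 1 \<omega>) (X 2 \<omega>)\<bar> < 0"
      using Lstat_less_iff[OF assms, of n X \<omega> 0, THEN iffD1, rule_format, of 1 2] assms by simp
    then show False by simp
  qed
  show "Lstat n p X \<omega> \<le> 1"
  proof (rule ccontr)
    assume gt: "\<not> Lstat n p X \<omega> \<le> 1"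
    have "Lstat n p X \<omega> < Lstat n p X \<omega>"
      using order_le_less_trans[OF abs_rho_le_1] gt by (subst Lstat_less_iff[OF assms]) (simp add: not_le)
    then show False by simp
  qed
qed

lemma Lstat_square_less_iff:
  assumes "2 \<le> p" "0 \<le> c"
  shows "(Lstat n p X \<omega>)\<^sup>2 < c \<longleftrightarrow>
    (\<forall>i j. 1 \<le> i \<and> i < j \<and> j \<le> p \<longrightarrow> (rho n (X i \<omega>) (X j \<omega>))\<^sup>2 < c)"
proof -
  have sq: "x\<^sup>2 < c \<longleftrightarrow> \<bar>x\<bar> < sqrt c" for x
    using real_sqrt_less_iff[of "x\<^sup>2" c] by simp
  show ?thesis
    unfolding sq abs_of_nonneg[OF Lstat_bounds(1)[OF assms(1)]] by (rule Lstat_less_iff[OF assms(1)])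
qed

locale spherical_sample = prob_space M for M :: "'a measure" +
  fixes n p :: nat and X :: "nat \<Rightarrow> 'a \<Rightarrow> nat \<Rightarrow> real"
  assumes n: "2 \<le> n" and p: "2 \<le> p"
    and indep: "indep_vars (\<lambda>_. euclid n) X {1..p}"
    and spherical: "\<And>i. i \<in> {1..p} \<Longrightarrow> spherical M n (X i)"
    and nonzero: "\<And>i. i \<in> {1..p} \<Longrightarrow> prob {\<omega> \<in> space M. \<forall>k<n. X i \<omega> k = 0} = 0"
begin

lemma X_measurable: "i \<in> {1..p} \<Longrightarrow> X i \<in> measurable M (euclid n)"
  using spherical by (simp add: spherical_def)

lemma Lstat_measurable[measurable]: "(\<lambda>\<omega>. Lstat n p X \<omega>) \<in> borel_measurable M"
  unfolding Lstat_eq_Max_image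
  by (intro borel_measurable_Max pairs_finite borel_measurable_abs rho_measurable X_measurable) auto

lemma Tstat_measurable[measurable]: "(\<lambda>\<omega>. Tstat n p X \<omega>) \<in> borel_measurable M"
  unfolding Tstat_def by measurable

lemma indep_pair_relation_rho:
  "indep_pair_relation M (euclid n) X p (\<lambda>x y. 1 - s \<le> (rho n x y)\<^sup>2) (pair_tail n s)"
proof
  show "indep_vars (\<lambda>_. euclid n) X {1..p}" by (rule indep)
  show "{z \<in> space (euclid n \<Otimes>\<^sub>M euclid n). 1 - s \<le> (rho n (fst z) (snd z))\<^sup>2} \<in> sets (euclid n \<Otimes>\<^sub>M euclid n)"
    by measurable
  show "1 - s \<le> (rho n x y)\<^sup>2 \<longleftrightarrow> 1 - s \<le> (rho n y x)\<^sup>2" for x y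
    by (simp add: rho_commute)
  fix i j assume i: "i \<in> {1..p}" and j: "j \<in> {1..p}"
  show "AE \<omega> in M. prob {\<omega>' \<in> space M. 1 - s \<le> (rho n (X i \<omega>) (X j \<omega>'))\<^sup>2} = pair_tail n s"
    using AE_norm_vec_nonzero[OF X_measurable[OF i] nonzero[OF i]] AE_space
  proof eventually_elim
    case (elim \<omega>)
    note X_measurable[OF j, measurable]
    have x: "X i \<omega> \<in> space (euclid n)" using measurable_space[OF X_measurable[OF i]] elim by simp
    have R: "(\<lambda>\<omega>'. (rho n (X i \<omega>) (X j \<omega>'))\<^sup>2) \<in> borel_measurable M"
      using x by measurable
    have "pair_tail n s = measure (distr M borel (\<lambda>\<omega>'. (rho n (X i \<omega>) (X j \<omega>'))\<^sup>2)) {1 - s..}"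
      unfolding pair_tail_def
      using spherical_rho_square_distr[OF prob_space_axioms spherical[OF j] n nonzero[OF j] x] elim by simp
    also have "\<dots> = prob {\<omega>' \<in> space M. 1 - s \<le> (rho n (X i \<omega>) (X j \<omega>'))\<^sup>2}"
      using R by (subst measure_distr) (auto intro!: arg_cong[where f=prob])
    finally show ?case by simp
  qed
qed

lemma prob_Lstat_square_less:
  assumes "s \<le> 1"
  shows "\<bar>prob {\<omega> \<in> space M. (Lstat n p X \<omega>)\<^sup>2 < 1 - s} - exp (- (real p * (real p - 1) / 2 * pair_tail n s))\<bar>
     \<le> real p ^ 3 * (pair_tail n s)\<^sup>2"
proof -
  interpret R: indep_pair_relation M "euclid n" X p "\<lambda>x y. 1 - s \<le> (rho n x y)\<^sup>2" "pair_tail n s"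
    by (rule indep_pair_relation_rho)
  have "{\<omega> \<in> space M. (Lstat n p X \<omega>)\<^sup>2 < 1 - s} = R.unrelated p"
    unfolding R.unrelated_def not_le
    by (intro Collect_cong conj_cong refl Lstat_square_less_iff[OF p]) (use assms in simp)
  moreover have "0 \<le> pair_tail n s" by (simp add: pair_tail_def)
  ultimately show ?thesis
    using R.prob_unrelated_approx[of p] by simp
qed

text \<open>The case \<open>s = 0\<close> of the Poisson approximation: there \<open>q = 0\<close> and the error bound is \<open>0\<close>. This rules
out, up to a null set, the argument at which \<open>ln\<close> takes the default value \<open>ln 0 = 0\<close>.\<close>

lemma AE_Lstat_square_less_1: "AE \<omega> in M. (Lstat n p X \<omega>)\<^sup>2 < 1"
proof -
  have "pair_tail n 0 \<le> 0"
    using beta_half_tail(2)[of "(real n - 1) / 2" 0] n by (simp add: pair_tail_def)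
  then have "pair_tail n 0 = 0" by (simp add: pair_tail_def measure_le_0_iff)
  then have "prob {\<omega> \<in> space M. (Lstat n p X \<omega>)\<^sup>2 < 1} = 1"
    using prob_Lstat_square_less[of 0] prob_le_1 by (intro antisym) auto
  then show ?thesis
    by (subst (asm) prob_Collect_eq_1) auto
qed

lemma prob_Tstat_le:
  assumes "0 < s" "s \<le> 1"
  shows "prob {\<omega> \<in> space M. Tstat n p X \<omega> \<le> ln s} = 1 - prob {\<omega> \<in> space M. (Lstat n p X \<omega>)\<^sup>2 < 1 - s}"
proof -
  have "prob {\<omega> \<in> space M. Tstat n p X \<omega> \<le> ln s} = prob {\<omega> \<in> space M. \<not> (Lstat n p X \<omega>)\<^sup>2 < 1 - s}"
  proof (rule finite_measure_eq_AE)
    show "AE \<omega> in M. \<omega> \<in> {\<omega> \<in> space M. Tstat n p X \<omega> \<le> ln s} \<longleftrightarrow>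
        \<omega> \<in> {\<omega> \<in> space M. \<not> (Lstat n p X \<omega>)\<^sup>2 < 1 - s}"
      using AE_Lstat_square_less_1
    proof eventually_elim
      case (elim \<omega>)
      then have "Tstat n p X \<omega> \<le> ln s \<longleftrightarrow> 1 - (Lstat n p X \<omega>)\<^sup>2 \<le> s"
        unfolding Tstat_def using assms by (intro ln_le_cancel_iff) auto
      then show ?case by auto
    qed
  qed measurable
  also have "{\<omega> \<in> space M. \<not> (Lstat n p X \<omega>)\<^sup>2 < 1 - s} = space M - {\<omega> \<in> space M. (Lstat n p X \<omega>)\<^sup>2 < 1 - s}"
    by auto
  also have "prob \<dots> = 1 - prob {\<omega> \<in> space M. (Lstat n p X \<omega>)\<^sup>2 < 1 - s}"
    by (rule prob_compl) measurable
  finally show ?thesis .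
qed

end

definition normalized_Tstat :: "nat \<Rightarrow> nat \<Rightarrow> (nat \<Rightarrow> 'a \<Rightarrow> nat \<Rightarrow> real) \<Rightarrow> 'a \<Rightarrow> real" where
  "normalized_Tstat n p X \<omega> =
     real n * Tstat n p X \<omega> + 4 * real n / (real n - 1) * ln (real p) - ln (real n)"

lemma normalized_Tstat_le_iff:
  assumes "2 \<le> n"
  shows "normalized_Tstat n p X \<omega> \<le> y \<longleftrightarrow> Tstat n p X \<omega> \<le> ln (threshold n p y)"
proof -
  have "real n * ((y + ln (real n)) / real n - 4 / (real n - 1) * ln (real p)) =
     y + ln (real n) - 4 * real n / (real n - 1) * ln (real p)"
    using assms by (simp add: right_diff_distrib)
  then have "normalized_Tstat n p X \<omega> \<le> y \<longleftrightarrow>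
      real n * Tstat n p X \<omega> \<le> real n * ((y + ln (real n)) / real n - 4 / (real n - 1) * ln (real p))"
    by (auto simp: normalized_Tstat_def)
  then show ?thesis using assms by (simp add: threshold_def)
qed

section \<open>Limit theorems\<close>

definition limit_cdf :: "real \<Rightarrow> real" where
  "limit_cdf y = 1 - exp (- (1 / sqrt (2 * pi)) * exp (y / 2))"

lemma limit_cdf_at_top: "(limit_cdf \<longlongrightarrow> 1) at_top"
proof -
  have "filterlim (\<lambda>y::real. exp (y / 2)) at_top at_top" by real_asymp
  then have "filterlim (\<lambda>y::real. 1 / sqrt (2 * pi) * exp (y / 2)) at_top at_top"
    by (intro filterlim_tendsto_pos_mult_at_top[OF tendsto_const]) auto
  then have "((\<lambda>y::real. exp (- (1 / sqrt (2 * pi) * exp (y / 2)))) \<longlongrightarrow> 0) at_top"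
    by (intro filterlim_compose[OF exp_at_bot]) (simp only: filterlim_uminus_at_top)
  then have "((\<lambda>y::real. 1 - exp (- (1 / sqrt (2 * pi) * exp (y / 2)))) \<longlongrightarrow> 1 - 0) at_top"
    by (intro tendsto_intros)
  then show ?thesis by (simp add: limit_cdf_def[abs_def])
qed

lemma limit_cdf_at_bot: "(limit_cdf \<longlongrightarrow> 0) at_bot"
proof -
  have "((\<lambda>y::real. exp (y / 2)) \<longlongrightarrow> 0) at_bot" by real_asymp
  then have "((\<lambda>y::real. 1 - exp (- (1 / sqrt (2 * pi)) * exp (y / 2))) \<longlongrightarrow> 1 - exp (- (1 / sqrt (2 * pi)) * 0)) at_bot"
    by (intro tendsto_intros)
  then show ?thesis by (simp add: limit_cdf_def[abs_def])
qed

lemma limit_cdf_mono: "x \<le> y \<Longrightarrow> limit_cdf x \<le> limit_cdf y"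
  by (simp add: limit_cdf_def divide_right_mono)

lemma limit_cdf_continuous: "continuous (at_right a) limit_cdf"
  unfolding limit_cdf_def[abs_def] by (intro continuous_intros) simp_all

lemma real_distribution_limit: "real_distribution (interval_measure limit_cdf)"
  by (intro real_distribution_interval_measure limit_cdf_mono limit_cdf_continuous
      limit_cdf_at_top limit_cdf_at_bot)

lemma cdf_limit: "cdf (interval_measure limit_cdf) = limit_cdf"
  by (intro cdf_interval_measure limit_cdf_mono limit_cdf_continuous limit_cdf_at_bot)

locale spherical_array =
  fixes M :: "nat \<Rightarrow> 'a measure" and p :: "nat \<Rightarrow> nat"
    and X :: "nat \<Rightarrow> nat \<Rightarrow> 'a \<Rightarrow> nat \<Rightarrow> real"
  assumes growth: "filterlim (\<lambda>n. ln (real (p n)) / real n) at_top sequentially"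
    and sample: "\<forall>\<^sub>F n in sequentially. spherical_sample (M n) n (p n) (X n)"
begin

abbreviation "L n \<equiv> Lstat n (p n) (X n)"
abbreviation "T n \<equiv> Tstat n (p n) (X n)"
abbreviation "S n \<equiv> normalized_Tstat n (p n) (X n)"

lemma prob_S_tendsto:
  "(\<lambda>n. measure (M n) {\<omega> \<in> space (M n). S n \<omega> \<le> y}) \<longlonglongrightarrow> limit_cdf y"
proof -
  define s where "s = (\<lambda>n. threshold n (p n) y)"
  define g where "g = (\<lambda>n. exp (- (real (p n) * (real (p n) - 1) / 2 * pair_tail n (s n))))"
  define h where "h = (\<lambda>n. measure (M n) {\<omega> \<in> space (M n). (L n \<omega>)\<^sup>2 < 1 - s n})"
  have s0: "s \<longlonglongrightarrow> 0" unfolding s_def by (rule threshold_tendsto_0[OF growth])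
  have s1: "\<forall>\<^sub>F n in sequentially. s n < 1" using s0 by (rule order_tendstoD) simp
  have "(\<lambda>n. h n - g n) \<longlonglongrightarrow> 0"
  proof (rule Lim_null_comparison)
    show "(\<lambda>n. real (p n) ^ 3 * (pair_tail n (s n))\<^sup>2) \<longlonglongrightarrow> 0"
      unfolding s_def by (rule approximation_error_tendsto_0[OF growth])
    show "\<forall>\<^sub>F n in sequentially. norm (h n - g n) \<le> real (p n) ^ 3 * (pair_tail n (s n))\<^sup>2"
      using sample s1
    proof eventually_elim
      case (elim n)
      interpret spherical_sample "M n" n "p n" "X n" by (rule elim(1))
      show ?case using prob_Lstat_square_less[of "s n"] elim(2) by (simp add: h_def g_def)
    qed
  qed
  moreover have "g \<longlonglongrightarrow> exp (- (1 / sqrt (2 * pi) * exp (y / 2)))"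
    unfolding g_def s_def by (intro tendsto_exp tendsto_minus expected_pairs_tendsto[OF growth])
  ultimately have "(\<lambda>n. h n - g n + g n) \<longlonglongrightarrow> 0 + exp (- (1 / sqrt (2 * pi) * exp (y / 2)))"
    by (rule tendsto_add)
  from tendsto_diff[OF tendsto_const[of 1] this]
  have "(\<lambda>n. 1 - h n) \<longlonglongrightarrow> limit_cdf y" by (simp add: limit_cdf_def)
  then show ?thesis
  proof (rule Lim_transform_eventually)
    show "\<forall>\<^sub>F n in sequentially. 1 - h n = measure (M n) {\<omega> \<in> space (M n). S n \<omega> \<le> y}"
      using sample s1
    proof eventually_elim
      case (elim n)
      interpret spherical_sample "M n" n "p n" "X n" by (rule elim(1))
      have "0 < s n" by (simp add: s_def threshold_def)
      then show ?case
        unfolding normalized_Tstat_le_iff[OF n] h_def s_def[symmetric]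
        using prob_Tstat_le[of "s n"] elim(2) by (simp add: s_def)
    qed
  qed
qed

lemma weak_conv_S:
  "weak_conv_m (\<lambda>n. distr (M n) borel (S n)) (interval_measure limit_cdf)"
  unfolding weak_conv_m_def weak_conv_def cdf_limit
proof (intro allI impI)
  fix y
  show "(\<lambda>n. cdf (distr (M n) borel (S n)) y) \<longlonglongrightarrow> limit_cdf y"
  proof (rule Lim_transform_eventually[OF prob_S_tendsto])
    show "\<forall>\<^sub>F n in sequentially. measure (M n) {\<omega> \<in> space (M n). S n \<omega> \<le> y} = cdf (distr (M n) borel (S n)) y"
      using sample
    proof eventually_elim
      case (elim n)
      interpret spherical_sample "M n" n "p n" "X n" by (rule elim)
      have "S n \<in> borel_measurable (M n)"
        unfolding normalized_Tstat_def[abs_def] by measurable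
      then show ?case
        by (simp add: cdf_def measure_distr) (auto intro!: arg_cong[where f=prob])
    qed
  qed
qed

text \<open>Tightness: with probability close to \<open>1\<close> the normalized statistic lies in some fixed interval
\<open>(- y, y]\<close>, and there \<open>n T / log p + 4\<close> is bounded by
\<open>(\<bar>y\<bar> + log n) / log p + 4 / (n - 1)\<close>, which tends to \<open>0\<close>.\<close>

lemma scaled_T_tendsto_prob:
  "tendsto_prob M (\<lambda>n \<omega>. real n / ln (real (p n)) * T n \<omega>) (- 4)"
  unfolding tendsto_prob_def
proof (intro allI impI)
  fix e :: real assume e: "0 < e"
  let ?P = "\<lambda>n. measure (M n) {\<omega> \<in> space (M n). \<bar>real n / ln (real (p n)) * T n \<omega> - - 4\<bar> > e}"
  show "?P \<longlonglongrightarrow> 0"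
  proof (rule order_tendstoI)
    fix a :: real assume "a < 0"
    then show "\<forall>\<^sub>F n in sequentially. a < ?P n"
      by (intro always_eventually allI) (auto intro: less_le_trans)
  next
    fix d :: real assume d: "0 < d"
    (* the mass that the limit law leaves outside the interval from - y to y *)
    have "((\<lambda>y. 1 - limit_cdf y + limit_cdf (- y)) \<longlongrightarrow> 1 - 1 + 0) at_top"
      by (intro tendsto_intros limit_cdf_at_top
          filterlim_compose[OF limit_cdf_at_bot filterlim_uminus_at_bot_at_top])
    then have "\<forall>\<^sub>F y in at_top. 1 - limit_cdf y + limit_cdf (- y) < d"
      using d by (intro order_tendstoD(2)) auto
    then obtain y where y: "1 - limit_cdf y + limit_cdf (- y) < d"
      using eventually_happens' trivial_limit_at_top_linorder by blast
    let ?F = "\<lambda>y n. measure (M n) {\<omega> \<in> space (M n). S n \<omega> \<le> y}"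
    have "(\<lambda>n. 1 - ?F y n + ?F (- y) n) \<longlonglongrightarrow> 1 - limit_cdf y + limit_cdf (- y)"
      by (intro tendsto_intros prob_S_tendsto)
    then have small: "\<forall>\<^sub>F n in sequentially. 1 - ?F y n + ?F (- y) n < d"
      using y by (rule order_tendstoD)
    have ln_p: "filterlim (\<lambda>n. ln (real (p n))) at_top sequentially" by (rule ln_p_at_top[OF growth])
    have "(\<lambda>n. \<bar>y\<bar> / ln (real (p n))) \<longlonglongrightarrow> 0"
      by (rule tendsto_divide_0[OF tendsto_const filterlim_at_top_imp_at_infinity[OF ln_p]])
    moreover have "(\<lambda>n. (ln (real n) / real n) / (ln (real (p n)) / real n)) \<longlonglongrightarrow> 0"
    proof (rule tendsto_divide_0)
      show "(\<lambda>n. ln (real n) / real n) \<longlonglongrightarrow> 0" by real_asymp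
      show "filterlim (\<lambda>n. ln (real (p n)) / real n) at_infinity sequentially"
        by (rule filterlim_at_top_imp_at_infinity[OF growth])
    qed
    moreover have "(\<lambda>n. 4 / (real n - 1)) \<longlonglongrightarrow> 0" by real_asymp
    ultimately have "(\<lambda>n. \<bar>y\<bar> / ln (real (p n)) + (ln (real n) / real n) / (ln (real (p n)) / real n) + 4 / (real n - 1))
        \<longlonglongrightarrow> 0 + 0 + 0" by (intro tendsto_add)
    then have err: "\<forall>\<^sub>F n in sequentially.
        \<bar>y\<bar> / ln (real (p n)) + (ln (real n) / real n) / (ln (real (p n)) / real n) + 4 / (real n - 1) < e"
      using e by (intro order_tendstoD(2)) auto
    have "\<forall>\<^sub>F n in sequentially. 0 < ln (real (p n))"
      using ln_p unfolding filterlim_at_top_dense by blast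
    then show "\<forall>\<^sub>F n in sequentially. ?P n < d"
      using sample small err
    proof eventually_elim
      case (elim n)
      interpret spherical_sample "M n" n "p n" "X n" by (rule elim(2))
      have S_meas[measurable]: "S n \<in> borel_measurable (M n)"
        unfolding normalized_Tstat_def[abs_def] by measurable
      have "\<bar>real n / ln (real (p n)) * T n \<omega> - - 4\<bar> \<le> e" if "- y < S n \<omega>" "S n \<omega> \<le> y" for \<omega>
      proof -
        let ?l = "ln (real (p n))"
        have "real n / ?l * T n \<omega> - - 4 = S n \<omega> / ?l + ln (real n) / ?l - 4 / (real n - 1)"
        proof -
          have "S n \<omega> / ?l = real n / ?l * T n \<omega> + 4 * real n / (real n - 1) - ln (real n) / ?l"
            using elim(1) by (simp add: normalized_Tstat_def add_divide_distrib diff_divide_distrib)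
          moreover have "4 * real n / (real n - 1) = 4 + 4 / (real n - 1)"
            using n by (simp add: field_simps)
          ultimately show ?thesis by simp
        qed
        also have "\<bar>\<dots>\<bar> \<le> \<bar>S n \<omega> / ?l\<bar> + \<bar>ln (real n) / ?l\<bar> + \<bar>4 / (real n - 1)\<bar>" by linarith
        also have "\<bar>S n \<omega> / ?l\<bar> \<le> \<bar>y\<bar> / ?l"
          using elim(1) that by (simp add: abs_divide divide_right_mono)
        also have "\<bar>ln (real n) / ?l\<bar> = (ln (real n) / real n) / (?l / real n)"
          using elim(1) n by simp
        also have "\<bar>4 / (real n - 1)\<bar> = 4 / (real n - 1)" using n by simp
        finally show ?thesis using elim(4) by simp
      qed
      then have "?P n \<le> prob ((space (M n) - {\<omega> \<in> space (M n). S n \<omega> \<le> y}) \<union> {\<omega> \<in> space (M n). S n \<omega> \<le> - y})"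
        by (intro finite_measure_mono subsetI) (force simp: not_le not_less)+
      also have "\<dots> \<le> prob (space (M n) - {\<omega> \<in> space (M n). S n \<omega> \<le> y}) + ?F (- y) n"
        by (intro measure_Un_le) measurable
      also have "prob (space (M n) - {\<omega> \<in> space (M n). S n \<omega> \<le> y}) = 1 - ?F y n"
        by (rule prob_compl) measurable
      finally show ?case using elim(3) by simp
    qed
  qed
qed

text \<open>If \<open>\<bar>n T / log p + 4\<bar> \<le> 1\<close>, then \<open>T \<le> - 3 log p / n\<close>, which is eventually below
\<open>log \<epsilon>\<close> for a given \<open>\<epsilon> > 0\<close>; since \<open>1 - L \<le> 1 - L\<^sup>2\<close>, this keeps \<open>L\<close>
within \<open>\<epsilon>\<close> of \<open>1\<close>.\<close>

lemma L_tendsto_prob: "tendsto_prob M (\<lambda>n. L n) 1"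
  unfolding tendsto_prob_def
proof (intro allI impI)
  fix e :: real assume e: "0 < e"
  show "(\<lambda>n. measure (M n) {\<omega> \<in> space (M n). \<bar>L n \<omega> - 1\<bar> > e}) \<longlonglongrightarrow> 0"
  proof (rule tendsto_sandwich[OF _ _ tendsto_const])
    show "(\<lambda>n. measure (M n) {\<omega> \<in> space (M n). \<bar>real n / ln (real (p n)) * T n \<omega> - - 4\<bar> > 1}) \<longlonglongrightarrow> 0"
      using scaled_T_tendsto_prob unfolding tendsto_prob_def by (elim allE[of _ 1] impE) auto
    show "\<forall>\<^sub>F n in sequentially. 0 \<le> measure (M n) {\<omega> \<in> space (M n). \<bar>L n \<omega> - 1\<bar> > e}" by simp
    have "\<forall>\<^sub>F n in sequentially. - ln e / 3 < ln (real (p n)) / real n"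
      using growth unfolding filterlim_at_top_dense by blast
    moreover have "\<forall>\<^sub>F n in sequentially. 0 < ln (real (p n))"
      using ln_p_at_top[OF growth] unfolding filterlim_at_top_dense by blast
    ultimately show "\<forall>\<^sub>F n in sequentially. measure (M n) {\<omega> \<in> space (M n). \<bar>L n \<omega> - 1\<bar> > e} \<le>
        measure (M n) {\<omega> \<in> space (M n). \<bar>real n / ln (real (p n)) * T n \<omega> - - 4\<bar> > 1}"
      using sample
    proof eventually_elim
      case (elim n)
      interpret spherical_sample "M n" n "p n" "X n" by (rule elim(3))
      have "1 < \<bar>real n / ln (real (p n)) * T n \<omega> - - 4\<bar>" if "e < \<bar>L n \<omega> - 1\<bar>" for \<omega>
      proof -
        have L: "0 \<le> L n \<omega>" "L n \<omega> \<le> 1" by (rule Lstat_bounds[OF p])+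
        then have "(L n \<omega>)\<^sup>2 \<le> L n \<omega>" by (simp add: power2_eq_square mult_left_le)
        with L that have "e < 1 - (L n \<omega>)\<^sup>2" by linarith
        then have "ln e < T n \<omega>" using e by (simp add: Tstat_def)
        then have "- 3 * (ln (real (p n)) / real n) < T n \<omega>" using elim(1) by linarith
        then have "real n / ln (real (p n)) * (- 3 * (ln (real (p n)) / real n)) < real n / ln (real (p n)) * T n \<omega>"
          using elim(2) n by (intro mult_strict_left_mono) auto
        then show ?thesis using elim(2) n by simp
      qed
      then show ?case by (intro finite_measure_mono) (auto, measurable)
    qed
  qed
qed

end

theorem theorem5:
  fixes p :: "nat \<Rightarrow> nat"
    and M :: "nat \<Rightarrow> 'a measure"
    and X :: "nat \<Rightarrow> nat \<Rightarrow> 'a \<Rightarrow> nat \<Rightarrow> real"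
    and K :: real
  assumes p: "filterlim (\<lambda>n. ln (real (p n)) / real n) at_top sequentially"
    and prob: "\<And>n. 1 \<le> n \<Longrightarrow> prob_space (M n)"
    and indep: "\<And>n. 1 \<le> n \<Longrightarrow> prob_space.indep_vars (M n) (\<lambda>_. euclid n) (X n) {1..p n}"
    and spherical: "\<And>n i. 1 \<le> n \<Longrightarrow> i \<in> {1..p n} \<Longrightarrow> spherical (M n) n (X n i)"
    and common: "\<And>n i. 1 \<le> n \<Longrightarrow> i \<in> {1..p n} \<Longrightarrow>
                   distr (M n) (euclid n) (X n i) = distr (M n) (euclid n) (X n 1)"
    and nonzero: "\<And>n. 1 \<le> n \<Longrightarrow> 1 \<le> p n \<Longrightarrow>
                   measure (M n) {\<omega> \<in> space (M n). \<forall>k<n. X n 1 \<omega> k = 0} = 0"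
    and K: "K = 1 / sqrt (2 * pi)"
  shows "tendsto_prob M (\<lambda>n. Lstat n (p n) (X n)) 1 \<and>
         tendsto_prob M (\<lambda>n \<omega>. real n / ln (real (p n)) * Tstat n (p n) (X n) \<omega>) (- 4) \<and>
         (\<exists>\<mu>. real_distribution \<mu> \<and>
              (\<forall>y. cdf \<mu> y = 1 - exp (- K * exp (y / 2))) \<and>
              weak_conv_m
                (\<lambda>n. distr (M n) borel
                   (\<lambda>\<omega>. real n * Tstat n (p n) (X n) \<omega>
                        + 4 * real n / (real n - 1) * ln (real (p n)) - ln (real n)))
                \<mu>)"
proof -
  have "\<forall>\<^sub>F n in sequentially. 1 < real (p n)"
    using p_at_top[OF p] unfolding filterlim_at_top_dense by blast
  then have "\<forall>\<^sub>F n in sequentially. spherical_sample (M n) n (p n) (X n)"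
    using eventually_ge_at_top[of 2]
  proof eventually_elim
    case (elim n)
    interpret prob_space "M n" using elim by (intro prob) simp
    show ?case
    proof
      show "2 \<le> n" "2 \<le> p n" using elim by auto
      show "indep_vars (\<lambda>_. euclid n) (X n) {1..p n}" using elim by (intro indep) simp
      fix i assume i: "i \<in> {1..p n}"
      show "spherical (M n) n (X n i)" using elim i by (intro spherical) auto
      (* the vanishing of the first vector is a null event, and this is a property of the common law *)
      let ?Z = "{x \<in> space (euclid n). norm_vec n x = 0}"
      have Z: "?Z \<in> sets (euclid n)" by measurable
      have law: "measure (distr (M n) (euclid n) (X n j)) ?Z = prob {\<omega> \<in> space (M n). \<forall>k<n. X n j \<omega> k = 0}"
        if "j \<in> {1..p n}" for j
      proof -
        have "X n j \<in> measurable (M n) (euclid n)"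
          using spherical[of n j] that elim by (simp add: spherical_def)
        then show ?thesis
          using Z measurable_space[of "X n j" "M n" "euclid n"]
          by (subst measure_distr) (auto simp: norm_vec_eq_0_iff intro!: arg_cong[where f=prob])
      qed
      show "prob {\<omega> \<in> space (M n). \<forall>k<n. X n i \<omega> k = 0} = 0"
        using law[OF i] law[of 1] common[of n i] nonzero[of n] elim i by simp
    qed
  qed
  then interpret spherical_array M p X
    by (intro spherical_array.intro p)
  show ?thesis
    using L_tendsto_prob scaled_T_tendsto_prob real_distribution_limit cdf_limit weak_conv_S
    unfolding normalized_Tstat_def[abs_def]
    by (intro conjI exI[of _ "interval_measure limit_cdf"]) (auto simp: limit_cdf_def K)
qed

end
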